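(* The block designs $\Delta_3(S)$ (defined in the context), as $S$ ranges over a set of representatives of the $8615$ isomorphism classes of uniform $(6\times 6)/10$ semi-Latin squares, are $8615$ pairwise non-isomorphic $(36,84,14,6,2)$-BIBDs.
   Context: For integers $n>2$ and $k>0$, an $(n\times n)/k$ semi-Latin square is an $n\times n$ array of $k$-subsets (called blocks) of an $nk$-set (of treatments), such that each treatment occurs once in each row and once in each column of the array. It is uniform if every pair of blocks, not in the same row or column, intersect in the same positive number $\mu$ of treatments (in which case $k=\mu(n-1)$; for $(6\times 6)/10$, $\mu=2$). Two $(n\times n)/k$ semi-Latin squares are isomorphic if one can be obtained from the other by a sequence of zero or more of: permuting the rows, permuting the columns, transposing the array, and renaming the treatments. There are exactly $8615$ isomorphism classes of uniform $(6\times 6)/10$ semi-Latin squares. A $(v,b,r,k)$-design is a block design with $v$ treatments and $b$ blocks (a list, repetitions allowed), each block being a $k$-subset of the set of treatments, such that each treatment is in exactly $r$ blocks. It is a $(v,b,r,k,\lambda)$-balanced incomplete-block design (BIBD) if $1<k<v$ and every pair of distinct treatments occur together in exactly $\lambda$ blocks. Two $(v,b,r,k)$-designs are isomorphic if there is a bijection from the treatments of the first to those of the second which maps the list of blocks of the first onto that of the second in some order. The dual of a $(v,b,r,k)$-design is the $(b,v,k,r)$-design obtained by interchanging the roles of treatments and blocks. For a uniform $(n\times n)/(\mu(n-1))$ semi-Latin square $S$, let $\Delta(S)$ be its underlying block design, whose blocks are the $n^2$ cells of $S$. $\Delta_3(S)$ is obtained from $\Delta(S)$ by adding $\mu$ new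 treatments for each row and $\mu$ new treatments for each column (each new treatment being incident precisely with the blocks in its corresponding row or column), and then taking the dual. *)

theory Defs
  imports "HOL-Combinatorics.Permutations"
begin

text \<open>
  Rows and columns are indexed by \<open>{..<n}\<close>. The values of \<open>cell\<close> outside this range are
  irrelevant: no predicate or relation below depends on them.
\<close>

record 'a square =
  symbols :: "'a set"
  cell :: "nat \<Rightarrow> nat \<Rightarrow> 'a set"

definition semi_latin_square :: "nat \<Rightarrow> nat \<Rightarrow> 'a square \<Rightarrow> bool" where
  "semi_latin_square n k S \<longleftrightarrow>
     n > 2 \<and> k > 0 \<and>
     finite (symbols S) \<and> card (symbols S) = n * k \<and>
     (\<forall>i<n. \<forall>j<n. cell S i j \<subseteq> symbols S \<and> card (cell S i j) = k) \<and>
     (\<forall>x\<in>symbols S. \<forall>i<n. \<exists>!j. j < n \<and> x \<in> cell S i j) \<and>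
     (\<forall>x\<in>symbols S. \<forall>j<n. \<exists>!i. i < n \<and> x \<in> cell S i j)"

definition uniform_sls :: "nat \<Rightarrow> nat \<Rightarrow> 'a square \<Rightarrow> bool" where
  "uniform_sls n k S \<longleftrightarrow>
     semi_latin_square n k S \<and>
     (\<exists>\<mu>>0. \<forall>i<n. \<forall>j<n. \<forall>i'<n. \<forall>j'<n.
        i \<noteq> i' \<and> j \<noteq> j' \<longrightarrow> card (cell S i j \<inter> cell S i' j') = \<mu>)"

inductive sls_step :: "nat \<Rightarrow> 'a square \<Rightarrow> 'a square \<Rightarrow> bool" for n where
  permute_rows:
    "\<lbrakk>p permutes {..<n}; symbols T = symbols S;
      \<And>i j. i < n \<Longrightarrow> j < n \<Longrightarrow> cell T i j = cell S (p i) j\<rbrakk> \<Longrightarrow> sls_step n S T"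
| permute_columns:
    "\<lbrakk>p permutes {..<n}; symbols T = symbols S;
      \<And>i j. i < n \<Longrightarrow> j < n \<Longrightarrow> cell T i j = cell S i (p j)\<rbrakk> \<Longrightarrow> sls_step n S T"
| transpose:
    "\<lbrakk>symbols T = symbols S;
      \<And>i j. i < n \<Longrightarrow> j < n \<Longrightarrow> cell T i j = cell S j i\<rbrakk> \<Longrightarrow> sls_step n S T"
| rename:
    "\<lbrakk>bij_betw f (symbols S) (symbols T);
      \<And>i j. i < n \<Longrightarrow> j < n \<Longrightarrow> cell T i j = f ` cell S i j\<rbrakk> \<Longrightarrow> sls_step n S T"

definition sls_isomorphic :: "nat \<Rightarrow> 'a square \<Rightarrow> 'a square \<Rightarrow> bool" where
  "sls_isomorphic n = (sls_step n)\<^sup>*\<^sup>*"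

definition uniform_sls_classes :: "nat \<Rightarrow> nat \<Rightarrow> 'a square set set" where
  "uniform_sls_classes n k =
     {S. uniform_sls n k S} //
     {(S, T). uniform_sls n k S \<and> uniform_sls n k T \<and> sls_isomorphic n S T}"

definition uniform_sls_representatives :: "nat \<Rightarrow> nat \<Rightarrow> 'a square set \<Rightarrow> bool" where
  "uniform_sls_representatives n k R \<longleftrightarrow>
     (\<forall>S\<in>R. uniform_sls n k S) \<and>
     (\<forall>S. uniform_sls n k S \<longrightarrow> (\<exists>!T. T \<in> R \<and> sls_isomorphic n S T))"

text \<open>
  The list of blocks of a design is a family indexed by a finite set of labels, so that repeated
  blocks stay distinguishable and the labels can serve as the treatments of the dual.
\<close>

record ('p, 'b) block_design =
  treatments :: "'p set"
  labels :: "'b set"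
  block :: "'b \<Rightarrow> 'p set"

definition is_design :: "nat \<Rightarrow> nat \<Rightarrow> nat \<Rightarrow> nat \<Rightarrow> ('p, 'b) block_design \<Rightarrow> bool" where
  "is_design v b r k D \<longleftrightarrow>
     finite (treatments D) \<and> card (treatments D) = v \<and>
     finite (labels D) \<and> card (labels D) = b \<and>
     (\<forall>l\<in>labels D. block D l \<subseteq> treatments D \<and> card (block D l) = k) \<and>
     (\<forall>x\<in>treatments D. card {l \<in> labels D. x \<in> block D l} = r)"

definition is_bibd ::
  "nat \<Rightarrow> nat \<Rightarrow> nat \<Rightarrow> nat \<Rightarrow> nat \<Rightarrow> ('p, 'b) block_design \<Rightarrow> bool" where
  "is_bibd v b r k lam D \<longleftrightarrow>
     is_design v b r k D \<and> 1 < k \<and> k < v \<and>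
     (\<forall>x\<in>treatments D. \<forall>y\<in>treatments D.
        x \<noteq> y \<longrightarrow> card {l \<in> labels D. x \<in> block D l \<and> y \<in> block D l} = lam)"

definition design_isomorphic ::
  "('p, 'b) block_design \<Rightarrow> ('q, 'c) block_design \<Rightarrow> bool" where
  "design_isomorphic D E \<longleftrightarrow>
     (\<exists>f g. bij_betw f (treatments D) (treatments E) \<and>
            bij_betw g (labels D) (labels E) \<and>
            (\<forall>l\<in>labels D. block E (g l) = f ` block D l))"

definition dual :: "('p, 'b) block_design \<Rightarrow> ('b, 'p) block_design" where
  "dual D = \<lparr>treatments = labels D, labels = treatments D,
             block = (\<lambda>x. {l \<in> labels D. x \<in> block D l})\<rparr>"

definition Delta :: "nat \<Rightarrow> 'a square \<Rightarrow> ('a, nat \<times> nat) block_design" where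
  "Delta n S = \<lparr>treatments = symbols S, labels = {..<n} \<times> {..<n},
                block = (\<lambda>(i, j). cell S i j)\<rparr>"

datatype 'a ext_treatment = Orig 'a | Row nat nat | Col nat nat

definition add_row_col_treatments ::
  "nat \<Rightarrow> nat \<Rightarrow> ('a, nat \<times> nat) block_design \<Rightarrow> ('a ext_treatment, nat \<times> nat) block_design"
where
  "add_row_col_treatments n \<mu> D =
     \<lparr>treatments = Orig ` treatments D \<union>
                   {Row i m | i m. i < n \<and> m < \<mu>} \<union> {Col j m | j m. j < n \<and> m < \<mu>},
      labels = labels D,
      block = (\<lambda>(i, j). Orig ` block D (i, j) \<union> {Row i m | m. m < \<mu>} \<union> {Col j m | m. m < \<mu>})\<rparr>"

definition Delta3 ::
  "nat \<Rightarrow> nat \<Rightarrow> 'a square \<Rightarrow> (nat \<times> nat, 'a ext_treatment) block_design" where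
  "Delta3 n \<mu> S = dual (add_row_col_treatments n \<mu> (Delta n S))"

end

theory Submission
  imports Defs
begin

text \<open>
  An isomorphism from \<open>Delta3 6 2 S\<close> to \<open>Delta3 6 2 T\<close> sends the rows of \<open>S\<close> to six disjoint
  repeated blocks of \<open>Delta3 6 2 T\<close>, and likewise the columns. Such a parallel class consists
  of the rows, of the columns, or of pairs of equal treatments of \<open>T\<close> forming a Latin square.
  If the last case never occurs, the isomorphism permutes rows and columns or exchanges them, so
  it comes from an isomorphism of \<open>S\<close> with \<open>T\<close>.

  In the Latin square case the other 48 treatments are common transversals covering any two cells
  that lie in no common row, column or letter class exactly twice. A parity argument bounds, for every
  choice of sets of rows, columns and letters, a quadratic statistic of the Latin square. Taking
  the first row as identity and the second in one of the four cycle types of derangements of six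
  points leaves 760 Latin squares, and each of them breaks one of these bounds.
\<close>

subsection \<open>Enumeration of Latin squares of order 6\<close>

text \<open>Systems of distinct representatives of the candidate lists: a chosen letter is struck
  from all later lists, so no entry repeats.\<close>

fun row_fillings :: "nat list list \<Rightarrow> nat list list" where
  "row_fillings [] = [[]]"
| "row_fillings (S # Ss) =
     concat (map (\<lambda>x. map ((#) x) (row_fillings (map (removeAll x) Ss))) S)"

lemma row_fillings_complete:
  "list_all2 (\<lambda>x S. x \<in> set S) r Ss \<Longrightarrow> distinct r \<Longrightarrow> r \<in> set (row_fillings Ss)"
proof (induction Ss arbitrary: r rule: row_fillings.induct)
  case 1
  then show ?case by simp
next
  case (2 S Ss)
  then obtain x r' where r: "r = x # r'" "x \<in> set S" "list_all2 (\<lambda>x S. x \<in> set S) r' Ss"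
    by (auto simp: list_all2_Cons2)
  have "list_all2 (\<lambda>x S. x \<in> set S) r' (map (removeAll x) Ss)"
    using r 2(3) by (auto simp: list_all2_conv_all_nth)
  then show ?case
    using 2 r by auto
qed

text \<open>
  \<open>av\<close> lists for each column the letters not yet used in it, \<open>M\<close> the rows chosen so far, and the
  last argument the prescribed first entries of the remaining rows.
\<close>

fun all_completions :: "(nat list list \<Rightarrow> bool) \<Rightarrow> nat list list \<Rightarrow> nat list list \<Rightarrow> nat list \<Rightarrow> bool"
where
  "all_completions Q av M [] = Q M"
| "all_completions Q av M (f # fs) =
     list_all (\<lambda>r. all_completions Q (map2 removeAll r av) (M @ [r]) fs)
       (row_fillings ([f] # tl av))"

text \<open>Every admissible list of remaining rows is a branch of the search: the next row is a
  filling of the available letters, and since later rows differ from it in every column, striking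
  its letters does not affect them.\<close>

lemma all_completionsD:
  assumes "all_completions Q av M (map hd rest)"
    and "\<And>r. r \<in> set rest \<Longrightarrow> r \<noteq> [] \<and> distinct r \<and> list_all2 (\<lambda>x S. x \<in> set S) r av"
    and "sorted_wrt (list_all2 (\<noteq>)) rest"
  shows "Q (M @ rest)"
  using assms
proof (induction rest arbitrary: av M)
  case Nil
  then show ?case by simp
next
  case (Cons r rest)
  have r: "r \<noteq> []" "distinct r" "list_all2 (\<lambda>x S. x \<in> set S) r av"
    using Cons.prems(2)[of r] by auto
  have "list_all2 (\<lambda>x S. x \<in> set S) r ([hd r] # tl av)"
    using r by (cases r; cases av) auto
  then have "r \<in> set (row_fillings ([hd r] # tl av))"
    using r row_fillings_complete by blast
  then have "all_completions Q (map2 removeAll r av) (M @ [r]) (map hd rest)"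
    using Cons.prems(1) by (auto simp: list_all_iff)
  moreover have "r' \<noteq> [] \<and> distinct r' \<and> list_all2 (\<lambda>x S. x \<in> set S) r' (map2 removeAll r av)"
    if "r' \<in> set rest" for r'
  proof -
    have "list_all2 (\<noteq>) r r'"
      using Cons.prems(3) that by simp
    then show ?thesis
      using Cons.prems(2)[of r'] that r(3) by (fastforce simp: list_all2_conv_all_nth)
  qed
  ultimately show ?case
    using Cons.IH[of "map2 removeAll r av" "M @ [r]"] Cons.prems(3) by simp
qed

text \<open>The nested inequality is an exclusive or of three memberships. Cells are kept as triples
  of row, column and letter, which treats the three kinds of lines alike.\<close>

definition odd_cells ::
  "nat list \<Rightarrow> nat list \<Rightarrow> nat list \<Rightarrow> nat list list \<Rightarrow> (nat \<times> nat \<times> nat) list" where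
  "odd_cells A B C M =
     concat (map (\<lambda>(i, r). filter (\<lambda>(i, j, y). (i \<in> set A) \<noteq> ((j \<in> set B) \<noteq> (y \<in> set C)))
       (map (\<lambda>(j, y). (i, j, y)) (zip [0..<6] r))) (zip [0..<6] M))"

lemma set_odd_cells:
  assumes "length M = 6" "\<forall>r\<in>set M. length r = 6"
  shows "set (odd_cells A B C M) =
    {(i, j, M ! i ! j) | i j. i < 6 \<and> j < 6 \<and> ((i \<in> set A) \<noteq> ((j \<in> set B) \<noteq> (M ! i ! j \<in> set C)))}"
    (is "?L = ?R")
proof -
  have zip6: "set (zip [0..<6] xs) = {(i, xs ! i) | i. i < 6}" if "length xs = 6" for xs :: "'b list"
    using that by (auto simp: set_zip intro!: exI)
  have "?L = (\<Union>i<6. {(i, j, M ! i ! j) | j. j < 6 \<and> ((i \<in> set A) \<noteq> ((j \<in> set B) \<noteq> (M ! i ! j \<in> set C)))})"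
    using assms by (force simp: odd_cells_def zip6)
  also have "\<dots> = ?R" by auto
  finally show ?thesis .
qed

lemma distinct_odd_cells: "distinct (odd_cells A B C M)"
proof -
  let ?g = "\<lambda>i r. filter (\<lambda>(i, j, y). (i \<in> set A) \<noteq> ((j \<in> set B) \<noteq> (y \<in> set C)))
       (map (\<lambda>(j, y). (i, j, y)) (zip [0..<6] r))"
  have *: "distinct (concat (map (\<lambda>(i, r). ?g i r) (zip is Ms)))" if "distinct is" for "is" and Ms :: "nat list list"
    using that
  proof (induction "is" arbitrary: Ms)
    case Nil
    then show ?case by simp
  next
    case (Cons i "is")
    show ?case
    proof (cases Ms)
      case Nil
      then show ?thesis by simp
    next
      case (Cons r Ms')
      have "distinct (?g i r)"
        by (auto simp: distinct_map inj_on_def distinct_zipI1)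
      moreover have "set (?g i r) \<inter> set (concat (map (\<lambda>(i, r). ?g i r) (zip is Ms'))) = {}"
        using Cons.prems by (auto dest: set_zip_leftD)
      ultimately show ?thesis
        using Cons Cons.prems Cons.IH[of Ms'] by simp
    qed
  qed
  show ?thesis unfolding odd_cells_def by (rule *) simp
qed

section \<open>Evaluating the line statistic on lists\<close>

fun bump :: "nat \<Rightarrow> nat list \<Rightarrow> nat list" where
  "bump i [] = []"
| "bump 0 (n # ns) = Suc n # ns"
| "bump (Suc i) (n # ns) = n # bump i ns"

fun sum_squares :: "nat list \<Rightarrow> int" where
  "sum_squares [] = 0"
| "sum_squares (n # ns) = int n * int n + sum_squares ns"

text \<open>Collects, in one pass with one counter per line, the two quantities compared in
  \<open>line_count_bound\<close>: the number of cells, and the sum of the squared numbers of cells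
  on the rows, columns and letter classes.\<close>

fun tally :: "nat list \<Rightarrow> nat list \<Rightarrow> nat list \<Rightarrow> (nat \<times> nat \<times> nat) list \<Rightarrow> int \<Rightarrow> int \<times> int" where
  "tally rs cs ss [] m = (m, sum_squares rs + sum_squares cs + sum_squares ss)"
| "tally rs cs ss ((i, j, y) # ps) m = tally (bump i rs) (bump j cs) (bump y ss) ps (m + 1)"

definition zeros :: "nat list" where
  "zeros = [0, 0, 0, 0, 0, 0]"

text \<open>The strict negation of the inequality in \<open>line_count_bound\<close>, for
  \<open>m\<close> odd cells and total \<open>Q\<close> of squared line counts.\<close>

fun exceeds :: "int \<times> int \<Rightarrow> int \<Rightarrow> bool" where
  "exceeds (m, Q) v \<longleftrightarrow> m * m + 6 * m - 8 * m * v + 24 * v * v - 24 < Q"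

fun violates :: "nat list list \<Rightarrow> nat list \<times> nat list \<times> nat list \<times> int \<Rightarrow> bool" where
  "violates M (A, B, C, v) = exceeds (tally zeros zeros zeros (odd_cells A B C M) 0) v"

lemma length_bump [simp]: "length (bump i ns) = length ns"
  by (induction i ns rule: bump.induct) auto

lemma nth_bump: "k < length ns \<Longrightarrow> bump i ns ! k = ns ! k + of_bool (i = k)"
  by (induction i ns arbitrary: k rule: bump.induct) (auto simp: nth_Cons split: nat.split)

lemma length_fold_bump [simp]: "length (fold bump is ns) = length ns"
  by (induction "is" arbitrary: ns) auto

lemma nth_fold_bump: "k < length ns \<Longrightarrow> fold bump is ns ! k = ns ! k + count_list is k"
  by (induction "is" arbitrary: ns) (auto simp: nth_bump)

lemma sum_squares_conv: "sum_squares ns = (\<Sum>k<length ns. (int (ns ! k))\<^sup>2)"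
  by (induction ns) (auto simp: power2_eq_square sum.lessThan_Suc_shift simp del: sum.lessThan_Suc)

lemma sum_squares_fold_bump:
  "sum_squares (fold bump is zeros) = (\<Sum>k<6. (int (count_list is k))\<^sup>2)"
proof -
  have z: "length zeros = 6" "\<And>k. k < 6 \<Longrightarrow> zeros ! k = 0"
    by (auto simp: zeros_def nth_Cons split: nat.split)
  show ?thesis by (simp add: sum_squares_conv z nth_fold_bump)
qed

lemma tally_conv:
  "tally rs cs ss ps m = (m + int (length ps),
     sum_squares (fold bump (map fst ps) rs) + sum_squares (fold bump (map (fst \<circ> snd) ps) cs) +
     sum_squares (fold bump (map (snd \<circ> snd) ps) ss))"
  by (induction rs cs ss ps m rule: tally.induct) auto

lemma count_list_map_distinct:
  "distinct ps \<Longrightarrow> count_list (map f ps) k = card {p \<in> set ps. f p = k}"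
proof (induction ps)
  case Nil
  then show ?case by simp
next
  case (Cons p ps)
  have "{q \<in> set (p # ps). f q = k} =
    (if f p = k then insert p {q \<in> set ps. f q = k} else {q \<in> set ps. f q = k})" by auto
  then show ?case using Cons by simp
qed

section \<open>Standard second rows and their refutations by evaluation\<close>

text \<open>The first two rows are the identity and \<open>t\<close>, whose letters are already
  struck from the columns. When \<open>t\<close> begins with 1, prescribing 2 to 5 as the remaining
  first entries also makes the first column the identity, so reduced Latin squares are
  searched.\<close>

definition refuted :: "nat list \<Rightarrow> (nat list \<times> nat list \<times> nat list \<times> int) list \<Rightarrow> bool" where
  "refuted t cs \<longleftrightarrow> all_completions (\<lambda>M. list_ex (violates M) cs)
     (map2 removeAll t (map (\<lambda>i. removeAll i [0..<6]) [0..<6])) [[0..<6], t] [2..<6]"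

text \<open>The hypotheses of \<open>line_count_bound\<close>; distinctness lets lengths stand for
  cardinalities.\<close>

fun valid_split :: "nat list \<times> nat list \<times> nat list \<times> int \<Rightarrow> bool" where
  "valid_split (A, B, C, v) \<longleftrightarrow> distinct A \<and> distinct B \<and> distinct C \<and>
     set A \<subseteq> {..<6} \<and> set B \<subseteq> {..<6} \<and> set C \<subseteq> {..<6} \<and>
     odd (int (length A + length B + length C) + v)"

text \<open>Pointwise, \<open>p\<close> maps \<open>xs ! j\<close> to \<open>xs ! (t ! j)\<close>:
  naming points by their position in \<open>xs\<close> turns \<open>p\<close> into
  \<open>t\<close>.\<close>

definition conjugates :: "nat list \<Rightarrow> nat list \<Rightarrow> nat list \<Rightarrow> bool" where
  "conjugates p xs t \<longleftrightarrow> map ((!) p) xs = map ((!) xs) t \<and> distinct xs \<and> list_all (\<lambda>x. x < 6) xs"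

text \<open>The cycle type of a derangement of six points is 6, 3+3, 2+4 or 2+2+2. Each candidate
  list writes the cycles one after another, starting them at 0, \<open>a\<close> or
  \<open>b\<close>, and the matching standard permutation steps to the next entry within each
  cycle.\<close>

lemma derangement_types:
  "list_all (\<lambda>p.
     conjugates p [0, p!0, p!(p!0), p!(p!(p!0)), p!(p!(p!(p!0))), p!(p!(p!(p!(p!0))))] [1, 2, 3, 4, 5, 0] \<or>
     list_ex (\<lambda>b. conjugates p [0, p!0, p!(p!0), b, p!b, p!(p!b)] [1, 2, 0, 4, 5, 3] \<or>
       list_ex (\<lambda>a. conjugates p [a, p!a, b, p!b, p!(p!b), p!(p!(p!b))] [1, 0, 3, 4, 5, 2] \<or>
          conjugates p [0, p!0, a, p!a, b, p!b] [1, 0, 3, 2, 5, 4]) [0..<6]) [0..<6])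
     (row_fillings (map (\<lambda>i. removeAll i [0..<6]) [0..<6]))"
  by code_simp

text \<open>
  The entries \<open>(A, B, C, v)\<close> below were found by a greedy search; every Latin square with the
  first two rows in question violates the bound \<open>line_count_bound\<close> for at least one of them.
\<close>

definition splits_6 :: "(nat list \<times> nat list \<times> nat list \<times> int) list" where
  "splits_6 = [([0, 1], [0, 1, 2], [2, 3, 4], 3)]"

definition splits_33 :: "(nat list \<times> nat list \<times> nat list \<times> int) list" where
  "splits_33 =
    [([0, 1, 2], [0, 1, 2], [0, 3], 3), ([0, 1, 3], [1, 2], [0, 1, 3], 3),
     ([0, 1, 4], [1, 2], [0, 1, 4], 3), ([2, 3, 4], [1, 2], [2, 3, 4], 3)]"

definition splits_24 :: "(nat list \<times> nat list \<times> nat list \<times> int) list" where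
  "splits_24 =
    [([2, 4], [0, 2, 4], [0, 2, 4], 3), ([2, 3], [0, 2, 4], [0, 2, 4], 3),
     ([3, 4], [0, 2, 4], [0, 2, 4], 3), ([0, 2], [1, 3, 4], [1, 2, 3], 3),
     ([0, 1, 2], [1, 3, 4], [0, 1], 3), ([0, 1, 4], [1, 2], [0, 1, 4], 3)]"

definition splits_222 :: "(nat list \<times> nat list \<times> nat list \<times> int) list" where
  "splits_222 =
    [([0, 1, 2], [2, 3], [0, 1, 2], 3), ([0, 2, 4], [3, 4], [0, 2, 4], 3),
     ([1, 3, 4], [1, 2, 4], [1, 3, 4], 2), ([0, 2], [0, 1, 2], [0, 1, 3], 3)]"

lemma refuted_6: "refuted [1, 2, 3, 4, 5, 0] splits_6"
  by code_simp

lemma refuted_33: "refuted [1, 2, 0, 4, 5, 3] splits_33"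
  by code_simp

lemma refuted_24: "refuted [1, 0, 3, 4, 5, 2] splits_24"
  by code_simp

lemma refuted_222: "refuted [1, 0, 3, 2, 5, 4] splits_222"
  by code_simp

lemma valid_splits:
  "list_all valid_split splits_6" "list_all valid_split splits_33"
  "list_all valid_split splits_24" "list_all valid_split splits_222"
  by code_simp+

subsection \<open>Latin squares whose transversals cover unrelated cells twice\<close>

text \<open>
  Assumption \<open>pair_count\<close> says that the sets \<open>B x\<close>, together with every row, column and letter
  class taken twice, form a BIBD with 36 treatments, replication 14 and \<open>\<lambda> = 2\<close>.
\<close>

locale covered_net =
  fixes P :: "'p set" and r c s :: "'p \<Rightarrow> nat" and X :: "'x set" and B :: "'x \<Rightarrow> 'p set"
  assumes rc: "bij_betw (\<lambda>p. (r p, c p)) P ({..<6} \<times> {..<6})"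
    and rs: "bij_betw (\<lambda>p. (r p, s p)) P ({..<6} \<times> {..<6})"
    and cs: "bij_betw (\<lambda>p. (c p, s p)) P ({..<6} \<times> {..<6})"
    and finite_X: "finite X"
    and block_subset: "x \<in> X \<Longrightarrow> B x \<subseteq> P"
    and card_block: "x \<in> X \<Longrightarrow> card (B x) = 6"
    and pair_count: "p \<in> P \<Longrightarrow> q \<in> P \<Longrightarrow> int (card {x \<in> X. p \<in> B x \<and> q \<in> B x}) =
      2 + 12 * of_bool (p = q) - 2 * of_bool (r p = r q) - 2 * of_bool (c p = c q)
        - 2 * of_bool (s p = s q)"
begin

section \<open>Counting points, blocks and second moments\<close>

lemma finite_P: "finite P"
  using bij_betw_finite[OF rc] by simp

lemma card_P: "card P = 36"
  using bij_betw_same_card[OF rc] by simp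

lemma coord_less: "p \<in> P \<Longrightarrow> r p < 6" "p \<in> P \<Longrightarrow> c p < 6" "p \<in> P \<Longrightarrow> s p < 6"
  using bij_betwE[OF rc] bij_betwE[OF rs] by auto

text \<open>By \<open>pair_count\<close>, two distinct points on a common line lie in no common
  block. So \<open>t\<close> is injective on the six points of a block, and hence onto its six
  values.\<close>

lemma block_meets_lines:
  assumes x: "x \<in> X" and t: "t \<in> {r, c, s}"
  shows "bij_betw t (B x) {..<6}"
proof -
  have fin: "finite (B x)" using block_subset[OF x] finite_P finite_subset by blast
  have "inj_on t (B x)"
  proof (rule inj_onI, rule ccontr)
    fix p q assume pq: "p \<in> B x" "q \<in> B x" "t p = t q" "p \<noteq> q"
    then have P: "p \<in> P" "q \<in> P" using block_subset[OF x] by auto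
    have "x \<in> {x \<in> X. p \<in> B x \<and> q \<in> B x}" using x pq by simp
    then have "card {x \<in> X. p \<in> B x \<and> q \<in> B x} \<noteq> 0" using finite_X by auto
    then show False using pair_count[OF P] pq t by (auto simp: of_bool_def split: if_splits)
  qed
  moreover have "t ` B x \<subseteq> {..<6}"
    using block_subset[OF x] coord_less t by auto
  then have "t ` B x = {..<6}"
    using card_block[OF x] card_image[OF \<open>inj_on t (B x)\<close>] by (intro card_subset_eq) auto
  ultimately show ?thesis by (simp add: bij_betw_def)
qed

lemma card_point: "p \<in> P \<Longrightarrow> card {x \<in> X. p \<in> B x} = 8"
  using pair_count[of p p] by simp

text \<open>Exchange the sums; each point lies in 2 + 12 - 6 = 8 blocks.\<close>

lemma double_count:
  fixes e :: "'p \<Rightarrow> int"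
  shows "(\<Sum>x\<in>X. \<Sum>p\<in>B x. e p) = 8 * (\<Sum>p\<in>P. e p)"
proof -
  have "(\<Sum>x\<in>X. \<Sum>p\<in>B x. e p) = (\<Sum>x\<in>X. \<Sum>p\<in>{p\<in>P. p \<in> B x}. e p)"
    using block_subset by (intro sum.cong) (auto intro: arg_cong2[where f = sum])
  also have "\<dots> = (\<Sum>p\<in>P. \<Sum>x\<in>{x\<in>X. p \<in> B x}. e p)"
    using finite_X finite_P by (rule sum.swap_restrict)
  also have "\<dots> = (\<Sum>p\<in>P. 8 * e p)"
    by (intro sum.cong) (simp_all add: card_point)
  finally show ?thesis by (simp add: sum_distrib_left)
qed

lemma card_X: "card X = 48"
proof -
  have "(\<Sum>x\<in>X. \<Sum>p\<in>B x. 1) = 6 * int (card X)"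
    by (simp add: card_block)
  then show ?thesis using double_count[of "\<lambda>_. 1"] by (simp add: card_P)
qed

lemma sum_over_fibres:
  fixes e :: "'p \<Rightarrow> int"
  assumes "t \<in> {r, c, s}"
  shows "(\<Sum>p\<in>P. \<Sum>q\<in>P. e p * e q * of_bool (t p = t q)) = (\<Sum>i<6. (\<Sum>p\<in>{p\<in>P. t p = i}. e p)\<^sup>2)"
proof -
  have "t ` P \<subseteq> {..<6}" using coord_less assms by auto
  then have "(\<Sum>p\<in>P. \<Sum>q\<in>P. e p * e q * of_bool (t p = t q)) =
      (\<Sum>i<6. \<Sum>p\<in>{p\<in>P. t p = i}. \<Sum>q\<in>P. e p * e q * of_bool (t p = t q))"
    using finite_P by (intro sum.group[symmetric]) auto
  also have "\<dots> = (\<Sum>i<6. \<Sum>p\<in>{p\<in>P. t p = i}. \<Sum>q\<in>{q\<in>P. t q = i}. e p * e q)"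
    using finite_P by (intro sum.cong refl sum.mono_neutral_cong_right) auto
  also have "\<dots> = (\<Sum>i<6. (\<Sum>p\<in>{p\<in>P. t p = i}. e p)\<^sup>2)"
    by (simp add: power2_eq_square sum_product)
  finally show ?thesis .
qed

text \<open>Expand the square over pairs of points, exchange the sums and insert
  \<open>pair_count\<close>. The diagonal term collapses because \<open>e\<close> is idempotent, and
  the line terms become squared line sums by \<open>sum_over_fibres\<close>.\<close>

lemma second_moment:
  fixes e :: "'p \<Rightarrow> int"
  assumes "\<And>p. p \<in> P \<Longrightarrow> e p * e p = e p"
  shows "(\<Sum>x\<in>X. (\<Sum>p\<in>B x. e p)\<^sup>2) = 2 * (\<Sum>p\<in>P. e p)\<^sup>2 + 12 * (\<Sum>p\<in>P. e p)
     - 2 * (\<Sum>i<6. (\<Sum>p\<in>{p\<in>P. r p = i}. e p)\<^sup>2) - 2 * (\<Sum>i<6. (\<Sum>p\<in>{p\<in>P. c p = i}. e p)\<^sup>2)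
     - 2 * (\<Sum>i<6. (\<Sum>p\<in>{p\<in>P. s p = i}. e p)\<^sup>2)"
proof -
  let ?E = "\<lambda>p q. e p * e q"
  have sub: "B x = {p\<in>P. p \<in> B x}" if "x \<in> X" for x using block_subset[OF that] by auto
  have "(\<Sum>x\<in>X. (\<Sum>p\<in>B x. e p)\<^sup>2) = (\<Sum>x\<in>X. \<Sum>z\<in>{z\<in>P\<times>P. fst z \<in> B x \<and> snd z \<in> B x}. ?E (fst z) (snd z))"
  proof (intro sum.cong refl)
    fix x assume "x \<in> X"
    have "(\<Sum>p\<in>B x. e p)\<^sup>2 = (\<Sum>z\<in>B x \<times> B x. ?E (fst z) (snd z))"
      by (simp add: power2_eq_square sum_product sum.cartesian_product case_prod_unfold)
    also have "B x \<times> B x = {z\<in>P\<times>P. fst z \<in> B x \<and> snd z \<in> B x}"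
      using block_subset[OF \<open>x \<in> X\<close>] by auto
    finally show "(\<Sum>p\<in>B x. e p)\<^sup>2 = (\<Sum>z\<in>{z\<in>P\<times>P. fst z \<in> B x \<and> snd z \<in> B x}. ?E (fst z) (snd z))" .
  qed
  also have "\<dots> = (\<Sum>z\<in>P\<times>P. \<Sum>x\<in>{x\<in>X. fst z \<in> B x \<and> snd z \<in> B x}. ?E (fst z) (snd z))"
    using finite_X finite_P by (intro sum.swap_restrict) auto
  also have "\<dots> = (\<Sum>z\<in>P\<times>P. ?E (fst z) (snd z) * int (card {x\<in>X. fst z \<in> B x \<and> snd z \<in> B x}))"
    by (simp add: mult.commute)
  also have "\<dots> = (\<Sum>p\<in>P. \<Sum>q\<in>P. ?E p q * int (card {x\<in>X. p \<in> B x \<and> q \<in> B x}))"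
    by (simp add: sum.cartesian_product case_prod_unfold)
  also have "\<dots> = (\<Sum>p\<in>P. \<Sum>q\<in>P. 2 * ?E p q + 12 * (?E p q * of_bool (p = q))
      - 2 * (?E p q * of_bool (r p = r q)) - 2 * (?E p q * of_bool (c p = c q))
      - 2 * (?E p q * of_bool (s p = s q)))"
    by (intro sum.cong refl) (simp add: pair_count algebra_simps)
  also have "\<dots> = 2 * (\<Sum>p\<in>P. \<Sum>q\<in>P. ?E p q) + 12 * (\<Sum>p\<in>P. \<Sum>q\<in>P. ?E p q * of_bool (p = q))
      - 2 * (\<Sum>p\<in>P. \<Sum>q\<in>P. ?E p q * of_bool (r p = r q))
      - 2 * (\<Sum>p\<in>P. \<Sum>q\<in>P. ?E p q * of_bool (c p = c q))
      - 2 * (\<Sum>p\<in>P. \<Sum>q\<in>P. ?E p q * of_bool (s p = s q))"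
    by (simp add: sum.distrib sum_subtractf sum_distrib_left)
  also have "(\<Sum>p\<in>P. \<Sum>q\<in>P. ?E p q * of_bool (p = q)) = (\<Sum>p\<in>P. e p)"
  proof (intro sum.cong refl)
    fix p assume p: "p \<in> P"
    have "(\<Sum>q\<in>P. ?E p q * of_bool (p = q)) = (\<Sum>q\<in>P. if p = q then e p * e p else 0)"
      by (intro sum.cong) auto
    then show "(\<Sum>q\<in>P. ?E p q * of_bool (p = q)) = e p"
      using p finite_P assms by simp
  qed
  also have "(\<Sum>p\<in>P. \<Sum>q\<in>P. ?E p q) = (\<Sum>p\<in>P. e p)\<^sup>2"
    by (simp add: power2_eq_square sum_product)
  finally show ?thesis by (simp add: sum_over_fibres)
qed

text \<open>
  A block meets every line once, so the number of its cells \<open>p\<close> for which an odd number of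
  \<open>r p \<in> A\<close>, \<open>c p \<in> A'\<close>, \<open>s p \<in> A''\<close> hold has a fixed parity; hence it is never strictly
  between \<open>v - 1\<close> and \<open>v + 1\<close> for \<open>v\<close> of the other parity. Averaging the corresponding
  quadratic inequality over all blocks bounds the line counts of the odd cells.
\<close>
lemma line_count_bound:
  fixes A A' A'' :: "nat set" and v :: int
  assumes A: "A \<subseteq> {..<6}" "A' \<subseteq> {..<6}" "A'' \<subseteq> {..<6}"
    and parity: "odd (int (card A + card A' + card A'') + v)"
  defines "Os \<equiv> {p \<in> P. (r p \<in> A) \<noteq> ((c p \<in> A') \<noteq> (s p \<in> A''))}"
  defines "m \<equiv> int (card Os)"
  shows "(\<Sum>i<6. (int (card {p \<in> Os. r p = i}))\<^sup>2) + (\<Sum>i<6. (int (card {p \<in> Os. c p = i}))\<^sup>2)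
    + (\<Sum>i<6. (int (card {p \<in> Os. s p = i}))\<^sup>2) \<le> m * m + 6 * m - 8 * m * v + 24 * v * v - 24"
proof -
  define e :: "'p \<Rightarrow> int" where "e p = of_bool (p \<in> Os)" for p
  define n where "n x = (\<Sum>p\<in>B x. e p)" for x
  have e_sum: "(\<Sum>p\<in>{p\<in>P. T p}. e p) = int (card {p \<in> Os. T p})" for T
  proof -
    have "(\<Sum>p\<in>{p\<in>P. T p}. e p) = (\<Sum>p\<in>{p\<in>Os. T p}. 1)"
      using finite_P by (intro sum.mono_neutral_cong_right) (auto simp: e_def Os_def)
    then show ?thesis by simp
  qed
  have em: "(\<Sum>p\<in>P. e p) = m"
    using e_sum[of "\<lambda>_. True"] by (simp add: m_def)
  have nonneg: "0 \<le> (n x - v + 1) * (n x - v - 1)" if x: "x \<in> X" for x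
  proof -
    have hit: "(\<Sum>p\<in>B x. of_bool (t p \<in> S) :: int) = int (card S)" if "t \<in> {r, c, s}" "S \<subseteq> {..<6}" for t S
    proof -
      have "(\<Sum>p\<in>B x. of_bool (t p \<in> S) :: int) = (\<Sum>i<6. of_bool (i \<in> S))"
        using block_meets_lines[OF x that(1)] by (rule sum.reindex_bij_betw)
      also have "\<dots> = (\<Sum>i\<in>S. 1)"
        using that(2) by (intro sum.mono_neutral_cong_right) auto
      finally show ?thesis by simp
    qed
    let ?w = "\<lambda>p. of_bool (r p \<in> A) + of_bool (c p \<in> A') + of_bool (s p \<in> A'') :: int"
    \<comment> \<open>An exclusive or agrees modulo 2 with the sum of its three indicators, so every
      summand is even.\<close>
    have "even (\<Sum>p\<in>B x. ?w p - e p)"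
      using block_subset[OF x] by (intro dvd_sum) (auto simp: e_def Os_def of_bool_def)
    moreover have "(\<Sum>p\<in>B x. ?w p - e p) = int (card A + card A' + card A'') - n x"
      using A by (simp add: sum_subtractf sum.distrib hit n_def)
    ultimately have "even (n x - v + 1)" using parity by presburger
    \<comment> \<open>The two factors are consecutive even integers, whose product cannot be
      negative.\<close>
    then obtain k where "n x - v + 1 = 2 * k" by (rule evenE)
    moreover from this have "n x - v - 1 = 2 * (k - 1)" by simp
    ultimately have "(n x - v + 1) * (n x - v - 1) = 4 * (k * (k - 1))" by simp
    moreover have "0 \<le> k * (k - 1)"
      by (cases "k \<ge> 1") (auto simp: mult_nonneg_nonneg mult_nonpos_nonpos)
    ultimately show ?thesis by simp
  qed
  have "0 \<le> (\<Sum>x\<in>X. (n x - v + 1) * (n x - v - 1))"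
    using nonneg by (rule sum_nonneg)
  also have "\<dots> = (\<Sum>x\<in>X. (n x)\<^sup>2 - 2 * v * n x + (v * v - 1))"
    by (intro sum.cong) (auto simp: algebra_simps power2_eq_square)
  also have "\<dots> = (\<Sum>x\<in>X. (n x)\<^sup>2) - 2 * v * (\<Sum>x\<in>X. n x) + 48 * (v * v - 1)"
    by (simp add: sum.distrib sum_subtractf sum_distrib_left card_X)
  also have "(\<Sum>x\<in>X. n x) = 8 * m"
    using double_count[of e] by (simp add: n_def em)
  also have "(\<Sum>x\<in>X. (n x)\<^sup>2) = 2 * m\<^sup>2 + 12 * m
     - 2 * (\<Sum>i<6. (int (card {p \<in> Os. r p = i}))\<^sup>2) - 2 * (\<Sum>i<6. (int (card {p \<in> Os. c p = i}))\<^sup>2)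
     - 2 * (\<Sum>i<6. (int (card {p \<in> Os. s p = i}))\<^sup>2)"
    unfolding n_def by (subst second_moment) (simp_all add: e_sum em, simp add: e_def)
  finally show ?thesis by (simp add: algebra_simps power2_eq_square)
qed

section \<open>Isotopy and the Latin square of a net\<close>

text \<open>The conditions depend only on which coordinates agree, so rows, columns and letters may
  be permuted independently.\<close>

lemma relabel:
  assumes "bij_betw \<rho> {..<6} {..<6}" "bij_betw \<kappa> {..<6} {..<6}" "bij_betw \<sigma> {..<6} {..<6}"
  shows "covered_net P (\<rho> \<circ> r) (\<kappa> \<circ> c) (\<sigma> \<circ> s) X B"
proof -
  have pair: "bij_betw (\<lambda>p. ((f \<circ> t) p, (g \<circ> u) p)) P ({..<6} \<times> {..<6})"
    if "bij_betw f {..<6} {..<6}" "bij_betw g {..<6} {..<6}"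
      "bij_betw (\<lambda>p. (t p, u p)) P ({..<6} \<times> {..<6})" for f g :: "nat \<Rightarrow> nat" and t u
    using bij_betw_trans[OF that(3) bij_betw_map_prod[OF that(1,2)]]
    by (simp add: comp_def)
  have inj: "f (t p) = f (t q) \<longleftrightarrow> t p = t q" if "bij_betw f {..<6} {..<6}" "t \<in> {r, c, s}" "p \<in> P" "q \<in> P" for f :: "nat \<Rightarrow> nat" and t p q
    using that coord_less by (auto simp: bij_betw_def inj_on_def)
  show ?thesis
    by unfold_locales
      (use assms rc rs cs pair finite_X block_subset card_block pair_count inj in \<open>auto\<close>)
qed

definition cell_at :: "nat \<Rightarrow> nat \<Rightarrow> 'p" where
  "cell_at i j = the_inv_into P (\<lambda>p. (r p, c p)) (i, j)"

lemma cell_at: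
  assumes "i < 6" "j < 6"
  shows "cell_at i j \<in> P" "r (cell_at i j) = i" "c (cell_at i j) = j"
proof -
  have "(i, j) \<in> {..<6} \<times> {..<6}" using assms by simp
  then have "cell_at i j \<in> P \<and> (r (cell_at i j), c (cell_at i j)) = (i, j)"
    using rc f_the_inv_into_f_bij_betw[OF rc] bij_betwE[OF bij_betw_the_inv_into[OF rc]]
    unfolding cell_at_def by fastforce
  then show "cell_at i j \<in> P" "r (cell_at i j) = i" "c (cell_at i j) = j" by auto
qed

lemma cell_at_coords: "p \<in> P \<Longrightarrow> cell_at (r p) (c p) = p"
  using the_inv_into_f_f[of "\<lambda>p. (r p, c p)" P p] rc by (simp add: cell_at_def bij_betw_def)

definition latin :: "nat \<Rightarrow> nat \<Rightarrow> nat" where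
  "latin i j = s (cell_at i j)"

lemma latin_coords: "p \<in> P \<Longrightarrow> latin (r p) (c p) = s p"
  by (simp add: latin_def cell_at_coords)

lemma latin_less: "i < 6 \<Longrightarrow> j < 6 \<Longrightarrow> latin i j < 6"
  by (simp add: latin_def cell_at coord_less)

lemma bij_latin_row: "i < 6 \<Longrightarrow> bij_betw (latin i) {..<6} {..<6}"
proof -
  assume i: "i < 6"
  have "inj_on (latin i) {..<6}"
  proof (rule inj_onI)
    fix j k assume "j \<in> {..<6}" "k \<in> {..<6}" "latin i j = latin i k"
    then have "cell_at i j = cell_at i k"
      using i rs cell_at by (intro inj_onD[OF bij_betw_imp_inj_on[OF rs]]) (auto simp: latin_def)
    then show "j = k" using cell_at(3) i \<open>j \<in> _\<close> \<open>k \<in> _\<close> by (metis lessThan_iff)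
  qed
  then show ?thesis
    using latin_less[OF i] by (intro bij_betw_imageI endo_inj_surj) auto
qed

lemma bij_latin_column: "j < 6 \<Longrightarrow> bij_betw (\<lambda>i. latin i j) {..<6} {..<6}"
proof -
  assume j: "j < 6"
  have "inj_on (\<lambda>i. latin i j) {..<6}"
  proof (rule inj_onI)
    fix i k assume "i \<in> {..<6}" "k \<in> {..<6}" "latin i j = latin k j"
    then have "cell_at i j = cell_at k j"
      using j cs cell_at by (intro inj_onD[OF bij_betw_imp_inj_on[OF cs]]) (auto simp: latin_def)
    then show "i = k" using cell_at(2) j \<open>i \<in> _\<close> \<open>k \<in> _\<close> by (metis lessThan_iff)
  qed
  then show ?thesis
    using latin_less j by (intro bij_betw_imageI endo_inj_surj) auto
qed

text \<open>Carries \<open>line_count_bound\<close> over to the list computation: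
  \<open>odd_cells\<close> lists the coordinate triples of the odd points without repetition, so the
  counters of \<open>tally\<close> are the line counts.\<close>

lemma no_violation:
  defines "M \<equiv> map (\<lambda>i. map (latin i) [0..<6]) [0..<6]"
  assumes valid: "valid_split (A, A', A'', v)"
  shows "\<not> violates M (A, A', A'', v)"
proof -
  define ps where "ps = odd_cells A A' A'' M"
  define Os where "Os = {p \<in> P. (r p \<in> set A) \<noteq> ((c p \<in> set A') \<noteq> (s p \<in> set A''))}"
  let ?g = "\<lambda>p. (r p, c p, s p)"
  have M: "length M = 6" "\<forall>r\<in>set M. length r = 6" and nth: "\<And>i j. i < 6 \<Longrightarrow> j < 6 \<Longrightarrow> M ! i ! j = latin i j"
    by (auto simp: M_def)
  have "set ps = {(i, j, latin i j) | i j. i < 6 \<and> j < 6 \<and>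
      ((i \<in> set A) \<noteq> ((j \<in> set A') \<noteq> (latin i j \<in> set A'')))}"
    unfolding ps_def set_odd_cells[OF M] using nth by (safe; force)
  also have "\<dots> = ?g ` Os"
  proof (intro equalityI subsetI)
    fix z assume "z \<in> ?g ` Os"
    then show "z \<in> {(i, j, latin i j) | i j. i < 6 \<and> j < 6 \<and>
      ((i \<in> set A) \<noteq> ((j \<in> set A') \<noteq> (latin i j \<in> set A'')))}"
      using coord_less by (auto simp: Os_def latin_coords)
  next
    fix z assume "z \<in> {(i, j, latin i j) | i j. i < 6 \<and> j < 6 \<and>
      ((i \<in> set A) \<noteq> ((j \<in> set A') \<noteq> (latin i j \<in> set A'')))}"
    then obtain i j where z: "z = (i, j, latin i j)" "i < 6" "j < 6"
      "(i \<in> set A) \<noteq> ((j \<in> set A') \<noteq> (latin i j \<in> set A''))" by auto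
    then have "cell_at i j \<in> Os" "z = ?g (cell_at i j)"
      by (auto simp: Os_def cell_at latin_def)
    then show "z \<in> ?g ` Os" by blast
  qed
  finally have set_ps: "set ps = ?g ` Os" .
  have inj: "inj_on ?g Os"
    using rc by (auto simp: bij_betw_def inj_on_def Os_def)
  have dist: "distinct ps" unfolding ps_def by (rule distinct_odd_cells)
  have len: "length ps = card Os"
    using distinct_card[OF dist] card_image[OF inj] set_ps by simp
  have count: "count_list (map f ps) k = card {p \<in> Os. f (?g p) = k}" for f k
  proof -
    have "{z \<in> set ps. f z = k} = ?g ` {p \<in> Os. f (?g p) = k}"
      using set_ps by auto
    then show ?thesis
      unfolding count_list_map_distinct[OF dist]
      by (simp add: card_image inj_on_subset[OF inj])
  qed
  have cards: "card (set A) = length A" "card (set A') = length A'" "card (set A'') = length A''"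
    using valid by (auto simp: distinct_card)
  have "(\<Sum>i<6. (int (card {p \<in> Os. r p = i}))\<^sup>2) + (\<Sum>i<6. (int (card {p \<in> Os. c p = i}))\<^sup>2)
    + (\<Sum>i<6. (int (card {p \<in> Os. s p = i}))\<^sup>2)
      \<le> int (card Os) * int (card Os) + 6 * int (card Os) - 8 * int (card Os) * v + 24 * v * v - 24"
    unfolding Os_def using valid cards by (intro line_count_bound) auto
  then show ?thesis
    by (simp add: tally_conv sum_squares_fold_bump count len flip: ps_def)
qed

text \<open>A square in this normal form is one of the completions that \<open>refuted\<close> runs
  through, so it would violate some split, against \<open>no_violation\<close>.\<close>

lemma no_refutation:
  assumes row0: "\<And>j. j < 6 \<Longrightarrow> latin 0 j = j" and col0: "\<And>i. i < 6 \<Longrightarrow> latin i 0 = i"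
    and row1: "\<And>j. j < 6 \<Longrightarrow> latin 1 j = t ! j" and t: "length t = 6"
    and valid: "list_all valid_split splits"
  shows "\<not> refuted t splits"
proof
  assume ref: "refuted t splits"
  define row where "row i = map (latin i) [0..<6]" for i
  define rest where "rest = map row [2..<6]"
  define av where "av = map2 removeAll t (map (\<lambda>i. removeAll i [0..<6]) [0..<6])"
  have up: "[0..<6] = 0 # 1 # [2..<6]" by (simp add: upt_conv_Cons)
  have len: "length (row i) = 6" and nth: "j < 6 \<Longrightarrow> row i ! j = latin i j" for i j
    by (auto simp: row_def)
  have r0: "row 0 = [0..<6]" by (rule nth_equalityI) (auto simp: len nth row0)
  have r1: "row 1 = t" by (rule nth_equalityI) (auto simp: len nth row1[unfolded One_nat_def] t)
  have ne: "latin i j \<noteq> latin i' j" if "i < 6" "i' < 6" "j < 6" "i \<noteq> i'" for i i' j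
    using bij_betw_imp_inj_on[OF bij_latin_column[OF that(3)]] that by (auto simp: inj_on_def)
  have hd: "map hd rest = [2..<6]"
    unfolding rest_def by (auto simp: row_def col0 hd_map upt_conv_Cons)
  have av: "length av = 6" "\<And>j. j < 6 \<Longrightarrow> set (av ! j) = {..<6} - {j, t ! j}"
    by (auto simp: av_def t)
  have "list_ex (violates ([row 0, row 1] @ rest)) splits"
  proof (rule all_completionsD[where Q = "\<lambda>M. list_ex (violates M) splits" and av = av])
    show "all_completions (\<lambda>M. list_ex (violates M) splits) av [row 0, row 1] (map hd rest)"
      using ref unfolding refuted_def av_def[symmetric] hd r0 r1 .
    show "x \<noteq> [] \<and> distinct x \<and> list_all2 (\<lambda>x S. x \<in> set S) x av" if "x \<in> set rest" for x
    proof -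
      obtain i where i: "x = row i" "2 \<le> i" "i < 6" using \<open>x \<in> set rest\<close> by (auto simp: rest_def)
      have "distinct x"
        using bij_betw_imp_inj_on[OF bij_latin_row[OF i(3)]]
        by (simp add: i row_def distinct_map lessThan_atLeast0)
      moreover have "latin i j \<in> set (av ! j)" if "j < 6" for j
        using that i latin_less ne[of i 0 j] ne[of i 1 j] row0 row1 by (auto simp: av)
      then have "list_all2 (\<lambda>x S. x \<in> set S) x av"
        by (simp add: list_all2_conv_all_nth i len nth av)
      ultimately show ?thesis using i len[of i] by auto
    qed
    have "list_all2 (\<noteq>) (row i) (row i')" if "i < i'" "i' < 6" for i i'
      using that ne by (auto simp: list_all2_conv_all_nth len nth)
    then show "sorted_wrt (list_all2 (\<noteq>)) rest"
      unfolding rest_def sorted_wrt_map by (auto intro: sorted_wrt_mono_rel[OF _ sorted_wrt_upt])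
  qed
  moreover have "[row 0, row 1] @ rest = map (\<lambda>i. map (latin i) [0..<6]) [0..<6]"
    by (simp add: up rest_def row_def)
  ultimately show False
    using no_violation valid by (auto simp: list_ex_iff list_all_iff)
qed

end

section \<open>Normalising the first two rows\<close>

context covered_net
begin

lemma inconsistent: False
proof -
  define col0 where "col0 = the_inv_into {..<6} (latin 0)"
  have bij0: "bij_betw col0 {..<6} {..<6}"
    unfolding col0_def using bij_latin_row[of 0] by (simp add: bij_betw_the_inv_into)
  have col0: "col0 (latin 0 j) = j" if "j < 6" for j
    using bij_latin_row[of 0] that by (simp add: col0_def the_inv_into_f_f bij_betw_def)
  have col0_less: "col0 y < 6" if "y < 6" for y
    using bij_betwE[OF bij0] that by auto
  \<comment> \<open>Naming each letter by its column in the first row turns the second row into a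
    permutation of the columns. It is a derangement because the two rows differ in every
    column.\<close>
  define p where "p = map (\<lambda>j. col0 (latin 1 j)) [0..<6]"
  have len_p: "length p = 6" and nth_p: "p ! j = col0 (latin 1 j)" if "j < 6" for j
    using that by (auto simp: p_def)
  have ne: "latin 1 j \<noteq> latin 0 j" if "j < 6" for j
    using inj_onD[OF bij_betw_imp_inj_on[OF bij_latin_column[OF that]], of 1 0] by auto
  have p_neq: "col0 (latin 1 j) \<noteq> j" if "j < 6" for j
  proof
    assume "col0 (latin 1 j) = j"
    then have "latin 1 j = latin 0 j"
      using that f_the_inv_into_f_bij_betw[OF bij_latin_row[of 0], of "latin 1 j"] latin_less
      by (simp add: col0_def)
    then show False using ne that by simp
  qed
  have "inj_on (\<lambda>j. col0 (latin 1 j)) {..<6}"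
    using bij_betw_trans[OF bij_latin_row[of 1] bij0] by (simp add: bij_betw_def comp_def)
  then have "distinct p" by (simp add: p_def distinct_map lessThan_atLeast0)
  moreover have "list_all2 (\<lambda>x S. x \<in> set S) p (map (\<lambda>i. removeAll i [0..<6]) [0..<6])"
    using p_neq col0_less latin_less by (simp add: list_all2_conv_all_nth p_def)
  ultimately have p_in: "p \<in> set (row_fillings (map (\<lambda>i. removeAll i [0..<6]) [0..<6]))"
    by (rule row_fillings_complete[rotated])
  obtain xs t splits where conj: "conjugates p xs t" and xs: "length xs = 6"
    and t: "length t = 6" "list_all (\<lambda>x. x < 6) t" "t ! 0 = 1"
    and ref: "refuted t splits" "list_all valid_split splits"
  proof -
    have "\<exists>xs t splits. conjugates p xs t \<and> length xs = 6 \<and>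
      (t, splits) \<in> {([1, 2, 3, 4, 5, 0], splits_6), ([1, 2, 0, 4, 5, 3], splits_33),
        ([1, 0, 3, 4, 5, 2], splits_24), ([1, 0, 3, 2, 5, 4], splits_222)}"
    proof -
      have len: "length [a, b, c, d, e, f] = 6" for a b c d e f :: nat by simp
      show ?thesis
        using bspec[OF derangement_types[unfolded list_all_iff] p_in]
        unfolding list_ex_iff by (elim disjE bexE) (use len in blast)+
    qed
    then obtain xs t splits where *: "conjugates p xs t" "length xs = 6"
      and m: "(t, splits) \<in> {([1, 2, 3, 4, 5, 0], splits_6), ([1, 2, 0, 4, 5, 3], splits_33),
        ([1, 0, 3, 4, 5, 2], splits_24), ([1, 0, 3, 2, 5, 4], splits_222)}"
      by blast
    show ?thesis
    proof (rule that[OF *])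
      show "length t = 6" "list_all (\<lambda>x. x < 6) t" "t ! 0 = 1"
        using m by auto
      show "refuted t splits" "list_all valid_split splits"
        using m refuted_6 refuted_33 refuted_24 refuted_222 valid_splits by auto
    qed
  qed
  have t_less: "t ! j < 6" if "j < 6" for j using t that by (simp add: list_all_length)
  have xs_less: "xs ! j < 6" if "j < 6" for j
    using conj xs that by (simp add: conjugates_def list_all_length)
  have bij_xs: "bij_betw ((!) xs) {..<6} {..<6}"
  proof -
    have "inj_on ((!) xs) {..<6}" using conj xs by (auto simp: conjugates_def inj_on_def nth_eq_iff_index_eq)
    then show ?thesis using xs_less by (intro bij_betw_imageI endo_inj_surj) auto
  qed
  have px: "col0 (latin 1 (xs ! j)) = xs ! (t ! j)" if "j < 6" for j
  proof -
    have "map ((!) p) xs ! j = map ((!) xs) t ! j" using conj by (simp add: conjugates_def)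
    then show ?thesis using that xs t nth_p[OF xs_less[OF that]] by simp
  qed
  define idx where "idx = the_inv_into {..<6} ((!) xs)"
  have bij_idx: "bij_betw idx {..<6} {..<6}"
    unfolding idx_def using bij_xs by (rule bij_betw_the_inv_into)
  have idx: "idx (xs ! j) = j" if "j < 6" for j
    using bij_xs that by (simp add: idx_def the_inv_into_f_f bij_betw_def)
  \<comment> \<open>With columns renamed by \<open>idx\<close>, the letter names
    \<open>\<sigma>\<close> make the first row the identity and turn the second into
    \<open>t\<close>. Naming each row by its new letter in column \<open>xs ! 0\<close> makes the
    first column the identity.\<close>
  define \<sigma> where "\<sigma> = idx \<circ> col0"
  define \<rho> where "\<rho> = \<sigma> \<circ> (\<lambda>i. latin i (xs ! 0))"
  have bij_\<sigma>: "bij_betw \<sigma> {..<6} {..<6}"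
    unfolding \<sigma>_def using bij0 bij_idx by (rule bij_betw_trans)
  have bij_\<rho>: "bij_betw \<rho> {..<6} {..<6}"
    unfolding \<rho>_def using bij_latin_column[OF xs_less] bij_\<sigma> by (intro bij_betw_trans) auto
  interpret N: covered_net P "\<rho> \<circ> r" "idx \<circ> c" "\<sigma> \<circ> s" X B
    using bij_\<rho> bij_idx bij_\<sigma> by (rule relabel)
  have N: "N.latin (\<rho> i) j = \<sigma> (latin i (xs ! j))" if "i < 6" "j < 6" for i j
    using N.latin_coords[of "cell_at i (xs ! j)"] cell_at[OF that(1) xs_less[OF that(2)]] idx[OF that(2)]
    by (simp add: latin_def)
  have "\<rho> 0 = 0" by (simp add: \<rho>_def \<sigma>_def col0 xs_less idx)
  \<comment> \<open>The second row keeps index 1 because \<open>t\<close> starts with 1.\<close>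
  have "\<rho> 1 = 1" using px[of 0] by (simp add: \<rho>_def \<sigma>_def t idx)
  have "\<not> refuted t splits"
  proof (rule N.no_refutation)
    show "N.latin 0 j = j" if "j < 6" for j
      using N[of 0 j] that by (simp add: \<open>\<rho> 0 = 0\<close> \<sigma>_def col0 xs_less idx)
    show "N.latin i 0 = i" if "i < 6" for i
    proof -
      have "i \<in> \<rho> ` {..<6}" using bij_betw_imp_surj_on[OF bij_\<rho>] that by simp
      then obtain i' where i': "i' < 6" "i = \<rho> i'" by auto
      have "N.latin (\<rho> i') 0 = \<sigma> (latin i' (xs ! 0))" using i'(1) by (intro N) simp_all
      also have "\<dots> = \<rho> i'" by (simp add: \<rho>_def)
      finally show ?thesis by (simp only: i'(2))
    qed
    show "N.latin 1 j = t ! j" if "j < 6" for j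
      using N[of 1 j] px[OF that] that unfolding \<open>\<rho> 1 = 1\<close> by (simp add: \<sigma>_def idx t_less)
  qed (use t ref in auto)
  then show False using ref by simp
qed

end

subsection \<open>The designs of semi-Latin squares\<close>

lemma cell_subset: "semi_latin_square n k S \<Longrightarrow> i < n \<Longrightarrow> j < n \<Longrightarrow> cell S i j \<subseteq> symbols S"
  by (simp add: semi_latin_square_def)

lemma card_cell: "semi_latin_square n k S \<Longrightarrow> i < n \<Longrightarrow> j < n \<Longrightarrow> card (cell S i j) = k"
  by (simp add: semi_latin_square_def)

lemma finite_cell: "semi_latin_square n k S \<Longrightarrow> i < n \<Longrightarrow> j < n \<Longrightarrow> finite (cell S i j)"
  unfolding semi_latin_square_def by (meson finite_subset)

lemma symbol_in_row:
  assumes "semi_latin_square n k S" "x \<in> symbols S" "i < n"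
  shows "\<exists>!j. j < n \<and> x \<in> cell S i j"
  using assms by (simp add: semi_latin_square_def)

lemma symbol_in_column:
  assumes "semi_latin_square n k S" "x \<in> symbols S" "j < n"
  shows "\<exists>!i. i < n \<and> x \<in> cell S i j"
  using assms by (simp add: semi_latin_square_def)

lemma row_unique:
  assumes "semi_latin_square n k S" "x \<in> cell S i j" "x \<in> cell S i j'" "i < n" "j < n" "j' < n"
  shows "j = j'"
  using symbol_in_row[OF assms(1) _ assms(4)] cell_subset[OF assms(1)] assms by blast

lemma column_unique:
  assumes "semi_latin_square n k S" "x \<in> cell S i j" "x \<in> cell S i' j" "i < n" "i' < n" "j < n"
  shows "i = i'"
  using symbol_in_column[OF assms(1) _ assms(6)] cell_subset[OF assms(1)] assms by blast

text \<open>Uniformity only asserts that some intersection size \<open>\<nu>\<close> exists. Each of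
  the \<open>k\<close> symbols of cell (0, 0) occurs once in each of the other \<open>n - 1\<close>
  rows, never in column 0; counting these occurrences gives (n - 1) k = (n - 1)^2 \<nu>.\<close>

lemma uniform_intersection:
  assumes U: "uniform_sls n k S" and k: "k = \<mu> * (n - 1)"
    and ij: "i < n" "j < n" "i' < n" "j' < n" "i \<noteq> i'" "j \<noteq> j'"
  shows "card (cell S i j \<inter> cell S i' j') = \<mu>"
proof -
  have sls: "semi_latin_square n k S" using U by (simp add: uniform_sls_def)
  then have n: "n > 2" by (simp add: semi_latin_square_def)
  obtain \<nu> where \<nu>: "\<And>i j i' j'. \<lbrakk>i < n; j < n; i' < n; j' < n; i \<noteq> i'; j \<noteq> j'\<rbrakk>
      \<Longrightarrow> card (cell S i j \<inter> cell S i' j') = \<nu>"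
  proof -
    obtain \<nu> where "\<forall>i<n. \<forall>j<n. \<forall>i'<n. \<forall>j'<n.
        i \<noteq> i' \<and> j \<noteq> j' \<longrightarrow> card (cell S i j \<inter> cell S i' j') = \<nu>"
      using U unfolding uniform_sls_def by (elim conjE exE)
    then show ?thesis using that by simp
  qed
  let ?I = "{1..<n}"
  have "(\<Sum>i\<in>?I. \<Sum>j\<in>?I. card (cell S 0 0 \<inter> cell S i j)) = (n - 1) * ((n - 1) * \<nu>)"
    using n by (simp add: \<nu>)
  moreover have "(\<Sum>j\<in>?I. card (cell S 0 0 \<inter> cell S i j)) = k" if i: "i \<in> ?I" for i
  proof -
    have "(\<Sum>j\<in>?I. card (cell S 0 0 \<inter> cell S i j)) = card (\<Union>j\<in>?I. cell S 0 0 \<inter> cell S i j)"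
      using i finite_cell[OF sls] row_unique[OF sls] by (subst card_UN_disjoint) auto
    also have "(\<Union>j\<in>?I. cell S 0 0 \<inter> cell S i j) = cell S 0 0"
    proof -
      have "\<exists>j\<in>?I. x \<in> cell S i j" if x: "x \<in> cell S 0 0" for x
      proof -
        have "x \<in> symbols S" using cell_subset[OF sls, of 0 0] x n by auto
        then obtain j where j: "j < n" "x \<in> cell S i j"
          using symbol_in_row[OF sls, of x i] i by auto
        have "j \<noteq> 0"
        proof
          assume "j = 0"
          then have "0 = i" using column_unique[OF sls x, of i] j i n by simp
          then show False using i by simp
        qed
        then show ?thesis using j by auto
      qed
      then show ?thesis by auto
    qed
    finally show ?thesis using card_cell[OF sls] n by simp
  qed
  ultimately have "(n - 1) * k = (n - 1) * ((n - 1) * \<nu>)" by simp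
  then have "\<nu> = \<mu>" using k n by simp
  then show ?thesis using \<nu> ij by simp
qed

lemma card_cell_inter:
  assumes U: "uniform_sls n k S" and k: "k = \<mu> * (n - 1)"
    and ij: "i < n" "j < n" "i' < n" "j' < n"
  shows "card (cell S i j \<inter> cell S i' j') =
    (if i = i' then if j = j' then k else 0 else if j = j' then 0 else \<mu>)"
proof -
  have sls: "semi_latin_square n k S" using U by (simp add: uniform_sls_def)
  have "cell S i j \<inter> cell S i j' = {}" if "j \<noteq> j'"
    using row_unique[OF sls, of _ i j j'] ij that by auto
  moreover have "cell S i j \<inter> cell S i' j = {}" if "i \<noteq> i'"
    using column_unique[OF sls, of _ i j i'] ij that by auto
  ultimately show ?thesis
    using uniform_intersection[OF U k ij] card_cell[OF sls ij(1,2)]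
    by (cases "i = i'"; cases "j = j'") simp_all
qed

lemma treatments_Delta3: "treatments (Delta3 n \<mu> S) = {..<n} \<times> {..<n}"
  by (simp add: Delta3_def dual_def add_row_col_treatments_def Delta_def)

lemma labels_Delta3: "labels (Delta3 n \<mu> S) =
    Orig ` symbols S \<union> {Row i m | i m. i < n \<and> m < \<mu>} \<union> {Col j m | j m. j < n \<and> m < \<mu>}"
  by (simp add: Delta3_def dual_def add_row_col_treatments_def Delta_def)

lemma label_cases:
  assumes "l \<in> labels (Delta3 n \<mu> S)"
  obtains (orig) x where "l = Orig x" "x \<in> symbols S"
    | (row) i m where "l = Row i m" "i < n" "m < \<mu>"
    | (col) j m where "l = Col j m" "j < n" "m < \<mu>"
  using assms unfolding labels_Delta3 Un_iff by (elim disjE imageE CollectE exE conjE) (rule that; assumption)+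

lemma block_Delta3_Orig: "block (Delta3 n \<mu> S) (Orig x) = {(i, j). i < n \<and> j < n \<and> x \<in> cell S i j}"
  by (auto simp: Delta3_def dual_def add_row_col_treatments_def Delta_def)

lemma block_Delta3_Row: "i < n \<Longrightarrow> m < \<mu> \<Longrightarrow> block (Delta3 n \<mu> S) (Row i m) = {i} \<times> {..<n}"
  by (auto simp: Delta3_def dual_def add_row_col_treatments_def Delta_def)

lemma block_Delta3_Col: "j < n \<Longrightarrow> m < \<mu> \<Longrightarrow> block (Delta3 n \<mu> S) (Col j m) = {..<n} \<times> {j}"
  by (auto simp: Delta3_def dual_def add_row_col_treatments_def Delta_def)

lemmas block_Delta3 = block_Delta3_Orig block_Delta3_Row block_Delta3_Col

lemma card_symbol_block:
  assumes sls: "semi_latin_square n k S" and x: "x \<in> symbols S"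
  shows "card {(i, j). i < n \<and> j < n \<and> x \<in> cell S i j} = n"
proof -
  have "inj_on fst {(i, j). i < n \<and> j < n \<and> x \<in> cell S i j}"
    using row_unique[OF sls] by (auto simp: inj_on_def)
  moreover have "fst ` {(i, j). i < n \<and> j < n \<and> x \<in> cell S i j} = {..<n}"
  proof (intro equalityI subsetI)
    fix i assume "i \<in> {..<n}"
    then obtain j where "j < n" "x \<in> cell S i j" using symbol_in_row[OF sls x] by blast
    then show "i \<in> fst ` {(i, j). i < n \<and> j < n \<and> x \<in> cell S i j}"
      using \<open>i \<in> {..<n}\<close> by (intro image_eqI[of _ _ "(i, j)"]) auto
  qed auto
  ultimately show ?thesis using card_image by fastforce
qed

lemma finite_labels_Delta3: "finite (symbols S) \<Longrightarrow> finite (labels (Delta3 n \<mu> S))"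
  unfolding labels_Delta3 by (intro finite_UnI finite_image_set2 finite_imageI) simp_all

lemma card_labels_Delta3:
  assumes "finite (symbols S)"
  shows "card (labels (Delta3 n \<mu> S)) = card (symbols S) + 2 * n * \<mu>"
proof -
  have rows: "{Row i m | i m. i < n \<and> m < \<mu>} = case_prod Row ` ({..<n} \<times> {..<\<mu>})"
    and cols: "{Col i m | i m. i < n \<and> m < \<mu>} = case_prod Col ` ({..<n} \<times> {..<\<mu>})" by auto
  let ?O = "Orig ` symbols S" and ?R = "case_prod Row ` ({..<n} \<times> {..<\<mu>}) :: 'a ext_treatment set"
    and ?C = "case_prod Col ` ({..<n} \<times> {..<\<mu>}) :: 'a ext_treatment set"
  have "card (?O \<union> ?R \<union> ?C) = card (?O \<union> ?R) + card ?C"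
    by (rule card_Un_disjoint) (use assms in auto)
  also have "card (?O \<union> ?R) = card ?O + card ?R"
    by (rule card_Un_disjoint) (use assms in auto)
  finally show ?thesis
    unfolding labels_Delta3 rows cols by (simp add: card_image inj_on_def)
qed

lemma pair_count_Delta3:
  fixes S :: "'a square"
  assumes sls: "semi_latin_square n k S" and ij: "i < n" "j < n" "i' < n" "j' < n"
  shows "card {l \<in> labels (Delta3 n \<mu> S). (i, j) \<in> block (Delta3 n \<mu> S) l \<and> (i', j') \<in> block (Delta3 n \<mu> S) l} =
    card (cell S i j \<inter> cell S i' j') + (if i = i' then \<mu> else 0) + (if j = j' then \<mu> else 0)"
proof -
  let ?O = "Orig ` (cell S i j \<inter> cell S i' j')"
  let ?R = "if i = i' then Row i ` {..<\<mu>} else {} :: 'a ext_treatment set"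
  let ?C = "if j = j' then Col j ` {..<\<mu>} else {} :: 'a ext_treatment set"
  have "{l \<in> labels (Delta3 n \<mu> S). (i, j) \<in> block (Delta3 n \<mu> S) l \<and> (i', j') \<in> block (Delta3 n \<mu> S) l}
      = ?O \<union> ?R \<union> ?C"
    using ij cell_subset[OF sls ij(1,2)] by (auto simp: labels_Delta3 block_Delta3)
  moreover have "card (?O \<union> ?R \<union> ?C) = card (?O \<union> ?R) + card ?C"
    by (rule card_Un_disjoint) (use finite_cell[OF sls ij(1,2)] in auto)
  moreover have "card (?O \<union> ?R) = card ?O + card ?R"
    by (rule card_Un_disjoint) (use finite_cell[OF sls ij(1,2)] in auto)
  moreover have "card ?O = card (cell S i j \<inter> cell S i' j')"
    by (simp add: card_image inj_on_def)
  moreover have "card ?R = (if i = i' then \<mu> else 0)" "card ?C = (if j = j' then \<mu> else 0)"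
    by (simp_all add: card_image inj_on_def)
  ultimately show ?thesis by simp
qed

text \<open>Two cells in a common row or column share no symbol but the \<mu> labels added for that
  line; any other two cells share exactly \<mu> symbols. A single cell lies in \<open>k\<close>
  symbol blocks and \<mu> blocks for each of its two lines.\<close>

lemma Delta3_is_bibd:
  assumes U: "uniform_sls n k S" and k: "k = \<mu> * (n - 1)"
  shows "is_bibd (n * n) (n * k + 2 * n * \<mu>) (k + 2 * \<mu>) n \<mu> (Delta3 n \<mu> S)"
proof -
  have sls: "semi_latin_square n k S" using U by (simp add: uniform_sls_def)
  have n: "n > 2" and sym: "finite (symbols S)" "card (symbols S) = n * k"
    using sls by (auto simp: semi_latin_square_def)
  let ?D = "Delta3 n \<mu> S"
  have blocks: "block ?D l \<subseteq> {..<n} \<times> {..<n} \<and> card (block ?D l) = n" if "l \<in> labels ?D" for l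
  proof -
    show ?thesis
      using that
    proof (cases rule: label_cases)
      case orig
      then show ?thesis using card_symbol_block[OF sls orig(2)] by (auto simp: block_Delta3_Orig)
    qed (auto simp: block_Delta3 card_cartesian_product)
  qed
  have points: "card {l \<in> labels ?D. p \<in> block ?D l} = k + 2 * \<mu>" if p: "p \<in> {..<n} \<times> {..<n}" for p
  proof -
    obtain i j where "p = (i, j)" "i < n" "j < n" using p by auto
    then show ?thesis
      using pair_count_Delta3[OF sls, of i j i j \<mu>] card_cell[OF sls, of i j] by simp
  qed
  have pairs: "card {l \<in> labels ?D. p \<in> block ?D l \<and> q \<in> block ?D l} = \<mu>"
    if p: "p \<in> {..<n} \<times> {..<n}" and q: "q \<in> {..<n} \<times> {..<n}" and pq: "p \<noteq> q" for p q
  proof -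
    obtain i j i' j' where ij: "p = (i, j)" "i < n" "j < n" "q = (i', j')" "i' < n" "j' < n"
      using p q by auto
    then show ?thesis
      using pq by (simp add: pair_count_Delta3[OF sls] card_cell_inter[OF U k])
  qed
  show ?thesis
    unfolding is_bibd_def is_design_def treatments_Delta3
    using n sym blocks points pairs
    by (simp add: finite_labels_Delta3 card_labels_Delta3 card_cartesian_product)
qed

section \<open>From maps of blocks to isomorphisms of squares\<close>

lemma sls_isomorphic_of_cell_map:
  fixes S T :: "'a square"
  assumes "bij_betw h (symbols S) (symbols T)" "\<rho> permutes {..<n}" "\<kappa> permutes {..<n}"
    and "\<And>i j. i < n \<Longrightarrow> j < n \<Longrightarrow> cell T i j = h ` cell S (\<rho> i) (\<kappa> j)"
  shows "sls_isomorphic n S T"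
proof -
  define S1 where "S1 = \<lparr>symbols = symbols T, cell = (\<lambda>i j. h ` cell S i j)\<rparr>"
  define S2 where "S2 = \<lparr>symbols = symbols T, cell = (\<lambda>i j. h ` cell S (\<rho> i) j)\<rparr>"
  have "sls_step n S S1"
    by (rule sls_step.rename[of h]) (simp_all add: S1_def assms(1))
  moreover have "sls_step n S1 S2"
    by (rule sls_step.permute_rows[of \<rho>]) (simp_all add: S1_def S2_def assms(2))
  moreover have "sls_step n S2 T"
    by (rule sls_step.permute_columns[of \<kappa>]) (simp_all add: S2_def assms(3,4))
  ultimately show ?thesis
    unfolding sls_isomorphic_def by (auto intro: rtranclp_trans)
qed

text \<open>If a symbol label went to a row or column label, the symbol would occur twice in one row
  or column of \<open>S\<close>. So symbols go to symbols, bijectively since both squares have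
  \<open>n * k\<close> of them, and the incidences determine the cells.\<close>

lemma sls_isomorphic_of_label_map:
  fixes S T :: "'a square"
  assumes S: "semi_latin_square n k S" and T: "semi_latin_square n k T"
    and \<rho>: "\<rho> permutes {..<n}" and \<kappa>: "\<kappa> permutes {..<n}"
    and inj: "inj_on (g \<circ> Orig) (symbols S)"
    and lab: "\<And>x. x \<in> symbols S \<Longrightarrow> g (Orig x) \<in> labels (Delta3 n \<mu> T)"
    and inc: "\<And>x i j. \<lbrakk>x \<in> symbols S; i < n; j < n\<rbrakk> \<Longrightarrow>
       (i, j) \<in> block (Delta3 n \<mu> T) (g (Orig x)) \<longleftrightarrow> x \<in> cell S (\<rho> i) (\<kappa> j)"
  shows "sls_isomorphic n S T"
proof -
  have n: "n > 2" using S by (simp add: semi_latin_square_def)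
  have less: "\<rho> i < n" "\<kappa> i < n" if "i < n" for i
    using that permutes_in_image[OF \<rho>] permutes_in_image[OF \<kappa>] by auto
  have ne: "\<rho> 0 \<noteq> \<rho> 1" "\<kappa> 0 \<noteq> \<kappa> 1"
    using permutes_inj[OF \<rho>] permutes_inj[OF \<kappa>] by (auto dest: injD)
  have "\<exists>y\<in>symbols T. g (Orig x) = Orig y" if x: "x \<in> symbols S" for x
  proof (rule ccontr)
    assume "\<not> ?thesis"
    then consider (row) i m where "g (Orig x) = Row i m" "i < n" "m < \<mu>"
      | (col) j m where "g (Orig x) = Col j m" "j < n" "m < \<mu>"
      using lab[OF x] by (auto simp: labels_Delta3)
    then show False
    proof cases
      case row
      then have "x \<in> cell S (\<rho> i) (\<kappa> 0)" "x \<in> cell S (\<rho> i) (\<kappa> 1)"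
        using inc[OF x, of i 0] inc[OF x, of i 1] n by (auto simp: block_Delta3)
      then show False using row_unique[OF S] ne less row n by auto
    next
      case col
      then have "x \<in> cell S (\<rho> 0) (\<kappa> j)" "x \<in> cell S (\<rho> 1) (\<kappa> j)"
        using inc[OF x, of 0 j] inc[OF x, of 1 j] n by (auto simp: block_Delta3)
      then show False using column_unique[OF S] ne less col n by auto
    qed
  qed
  then obtain h where h: "\<And>x. x \<in> symbols S \<Longrightarrow> h x \<in> symbols T \<and> g (Orig x) = Orig (h x)"
    by metis
  have "inj_on h (symbols S)"
    using inj h by (auto simp: inj_on_def)
  moreover have "h ` symbols S = symbols T"
    using h S T card_image[OF \<open>inj_on h (symbols S)\<close>]
    by (intro card_subset_eq) (auto simp: semi_latin_square_def)
  ultimately have bij: "bij_betw h (symbols S) (symbols T)" by (simp add: bij_betw_def)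
  have "cell T i j = h ` cell S (\<rho> i) (\<kappa> j)" if ij: "i < n" "j < n" for i j
  proof -
    have iff: "h x \<in> cell T i j \<longleftrightarrow> x \<in> cell S (\<rho> i) (\<kappa> j)" if "x \<in> symbols S" for x
      using inc[OF that ij] h[OF that] ij by (auto simp: block_Delta3)
    have "y \<in> h ` symbols S" if "y \<in> cell T i j" for y
      using that cell_subset[OF T ij] bij by (auto simp: bij_betw_def)
    then show ?thesis
      using iff cell_subset[OF S less(1)[OF ij(1)] less(2)[OF ij(2)]] by blast
  qed
  then show ?thesis using sls_isomorphic_of_cell_map[OF bij \<rho> \<kappa>] by blast
qed

section \<open>Parallel classes of repeated blocks\<close>

text \<open>The blocks \<open>l i\<close> are disjoint, while every symbol block and every column
  meets row \<open>a\<close>. Hence one row in the class forces all its members to be rows.\<close>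

lemma row_in_parallel_class:
  fixes T :: "'a square" and s :: "nat \<times> nat \<Rightarrow> nat" and n :: nat
  defines "G \<equiv> {..<n} \<times> {..<n}"
  assumes sls: "semi_latin_square n k T"
    and s_less: "\<And>p. p \<in> G \<Longrightarrow> s p < n"
    and lab: "\<And>i. i < n \<Longrightarrow> l i \<in> labels (Delta3 n \<mu> T)"
    and bl: "\<And>i. i < n \<Longrightarrow> block (Delta3 n \<mu> T) (l i) = {p \<in> G. s p = i}"
    and row: "i < n" "l i = Row a m"
    and pq: "p \<in> G" "q \<in> G"
  shows "s p = s q \<longleftrightarrow> fst p = fst q"
proof -
  have am: "a < n" "m < \<mu>" using lab[OF row(1)] row(2) by (auto simp: labels_Delta3)
  have a: "s (a, j) = i" if "j < n" for j
    using bl[OF row(1)] am row(2) that by (auto simp: block_Delta3)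
  have "\<exists>a'. {p \<in> G. s p = i'} = {a'} \<times> {..<n}" if i': "i' < n" for i'
    using lab[OF i']
  proof (cases rule: label_cases)
    case (orig x)
    then obtain j where "j < n" "x \<in> cell T a j"
      using symbol_in_row[OF sls _ am(1)] by blast
    then have "(a, j) \<in> block (Delta3 n \<mu> T) (l i')"
      using orig am by (simp add: block_Delta3)
    then have "i' = i" using bl[OF i'] a \<open>j < n\<close> by auto
    then show ?thesis using orig row by simp
  next
    case (col j m')
    then have "(a, j) \<in> block (Delta3 n \<mu> T) (l i')"
      using am by (simp add: block_Delta3)
    then have "i' = i" using bl[OF i'] a \<open>j < n\<close> by auto
    then show ?thesis using col row by simp
  next
    case (row a' m')
    then show ?thesis using bl[OF i'] by (auto simp: block_Delta3)
  qed
  then obtain a' where a': "{q \<in> G. s q = s p} = {a'} \<times> {..<n}"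
    using s_less[OF pq(1)] by blast
  have "p \<in> {a'} \<times> {..<n}" using pq(1) by (simp flip: a')
  moreover have "s q = s p \<longleftrightarrow> q \<in> {a'} \<times> {..<n}" using pq(2) by (simp flip: a')
  ultimately show ?thesis using pq by (auto simp: G_def)
qed

text \<open>The transposed version of \<open>row_in_parallel_class\<close>.\<close>

lemma column_in_parallel_class:
  fixes T :: "'a square" and s :: "nat \<times> nat \<Rightarrow> nat" and n :: nat
  defines "G \<equiv> {..<n} \<times> {..<n}"
  assumes sls: "semi_latin_square n k T"
    and s_less: "\<And>p. p \<in> G \<Longrightarrow> s p < n"
    and lab: "\<And>i. i < n \<Longrightarrow> l i \<in> labels (Delta3 n \<mu> T)"
    and bl: "\<And>i. i < n \<Longrightarrow> block (Delta3 n \<mu> T) (l i) = {p \<in> G. s p = i}"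
    and col: "i < n" "l i = Col a m"
    and pq: "p \<in> G" "q \<in> G"
  shows "s p = s q \<longleftrightarrow> snd p = snd q"
proof -
  have am: "a < n" "m < \<mu>" using lab[OF col(1)] col(2) by (auto simp: labels_Delta3)
  have a: "s (j, a) = i" if "j < n" for j
    using bl[OF col(1)] am col(2) that by (auto simp: block_Delta3)
  have "\<exists>a'. {p \<in> G. s p = i'} = {..<n} \<times> {a'}" if i': "i' < n" for i'
    using lab[OF i']
  proof (cases rule: label_cases)
    case (orig x)
    then obtain j where "j < n" "x \<in> cell T j a"
      using symbol_in_column[OF sls _ am(1)] by blast
    then have "(j, a) \<in> block (Delta3 n \<mu> T) (l i')"
      using orig am by (simp add: block_Delta3)
    then have "i' = i" using bl[OF i'] a \<open>j < n\<close> by auto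
    then show ?thesis using orig col by simp
  next
    case (row j m')
    then have "(j, a) \<in> block (Delta3 n \<mu> T) (l i')"
      using am by (simp add: block_Delta3)
    then have "i' = i" using bl[OF i'] a \<open>j < n\<close> by auto
    then show ?thesis using row col by simp
  next
    case (col a' m')
    then show ?thesis using bl[OF i'] by (auto simp: block_Delta3)
  qed
  then obtain a' where a': "{q \<in> G. s q = s p} = {..<n} \<times> {a'}"
    using s_less[OF pq(1)] by blast
  have "p \<in> {..<n} \<times> {a'}" using pq(1) by (simp flip: a')
  moreover have "s q = s p \<longleftrightarrow> q \<in> {..<n} \<times> {a'}" using pq(2) by (simp flip: a')
  ultimately show ?thesis using pq by (auto simp: G_def)
qed

text \<open>The fibres of \<open>s\<close> are the letter classes of a Latin square, each being the
  block of two symbols. Removing these twelve symbols leaves 48, whose blocks satisfy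
  \<open>covered_net\<close>, and that is inconsistent.\<close>

lemma no_doubled_latin_square:
  fixes T :: "'a square" and s :: "nat \<times> nat \<Rightarrow> nat"
  defines "G \<equiv> {..<6 :: nat} \<times> {..<6 :: nat}"
  assumes U: "uniform_sls 6 10 T"
    and s_less: "\<And>p. p \<in> G \<Longrightarrow> s p < 6"
    and sym: "\<And>i. i < 6 \<Longrightarrow> x i \<in> symbols T" "\<And>i. i < 6 \<Longrightarrow> y i \<in> symbols T"
    and ne: "\<And>i. i < 6 \<Longrightarrow> x i \<noteq> y i"
    and x: "\<And>i a b. \<lbrakk>i < 6; a < 6; b < 6\<rbrakk> \<Longrightarrow> x i \<in> cell T a b \<longleftrightarrow> s (a, b) = i"
    and y: "\<And>i a b. \<lbrakk>i < 6; a < 6; b < 6\<rbrakk> \<Longrightarrow> y i \<in> cell T a b \<longleftrightarrow> s (a, b) = i"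
  shows False
proof -
  have sls: "semi_latin_square 6 10 T" using U by (simp add: uniform_sls_def)
  define Z where "Z = x ` {..<6} \<union> y ` {..<6}"
  define B where "B z = {(a, b). a < 6 \<and> b < 6 \<and> z \<in> cell T a b}" for z
  have full: "bij_betw f G ({..<6} \<times> {..<6})" if "inj_on f G" "f ` G \<subseteq> {..<6} \<times> {..<6}"
    for f :: "nat \<times> nat \<Rightarrow> nat \<times> nat"
    using endo_inj_surj[of G f] that by (simp add: bij_betw_def G_def)
  have "inj_on (\<lambda>p. (fst p, s p)) G"
  proof (rule inj_onI)
    fix p q assume "p \<in> G" "q \<in> G" "(fst p, s p) = (fst q, s q)"
    moreover from this obtain a b b' where "p = (a, b)" "q = (a, b')" "a < 6" "b < 6" "b' < 6"
      by (auto simp: G_def)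
    ultimately show "p = q"
      using x[of "s p" a b] x[of "s p" a b'] s_less[of p] row_unique[OF sls, of "x (s p)" a b b'] by auto
  qed
  then have rs: "bij_betw (\<lambda>p. (fst p, s p)) G ({..<6} \<times> {..<6})"
    using s_less by (intro full) (auto simp: G_def)
  have "inj_on (\<lambda>p. (snd p, s p)) G"
  proof (rule inj_onI)
    fix p q assume "p \<in> G" "q \<in> G" "(snd p, s p) = (snd q, s q)"
    moreover from this obtain a a' b where "p = (a, b)" "q = (a', b)" "a < 6" "a' < 6" "b < 6"
      by (auto simp: G_def)
    ultimately show "p = q"
      using x[of "s p" a b] x[of "s p" a' b] s_less[of p] column_unique[OF sls, of "x (s p)" a b a'] by auto
  qed
  then have cs: "bij_betw (\<lambda>p. (snd p, s p)) G ({..<6} \<times> {..<6})"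
    using s_less by (intro full) (auto simp: G_def)
  have pair_count: "int (card {z \<in> symbols T - Z. p \<in> B z \<and> q \<in> B z}) =
      2 + 12 * of_bool (p = q) - 2 * of_bool (fst p = fst q) - 2 * of_bool (snd p = snd q)
        - 2 * of_bool (s p = s q)" if pq: "p \<in> G" "q \<in> G" for p q
  proof -
    obtain a b c d where ab: "p = (a, b)" "q = (c, d)" "a < 6" "b < 6" "c < 6" "d < 6"
      using pq by (auto simp: G_def)
    \<comment> \<open>The removed symbols that the two cells have in common.\<close>
    let ?W = "if s p = s q then {x (s p), y (s p)} else {}"
    have W: "?W \<subseteq> cell T a b \<inter> cell T c d"
      using ab x y s_less[of p] pq by auto
    have "{z \<in> symbols T - Z. p \<in> B z \<and> q \<in> B z} = cell T a b \<inter> cell T c d - ?W"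
    proof -
      have "z \<in> Z \<longleftrightarrow> z \<in> ?W" if "z \<in> cell T a b" "z \<in> cell T c d" for z
        using that ab x y s_less[of p] s_less[of q] pq by (auto simp: Z_def)
      then show ?thesis
        using cell_subset[OF sls ab(3,4)] ab by (auto simp: B_def)
    qed
    also have "card \<dots> = card (cell T a b \<inter> cell T c d) - card ?W"
      using W by (intro card_Diff_subset) auto
    also have "card ?W = 2 * of_bool (s p = s q)"
      using ne[of "s q"] s_less[of q] pq by simp
    finally have "card {z \<in> symbols T - Z. p \<in> B z \<and> q \<in> B z} =
      card (cell T a b \<inter> cell T c d) - 2 * of_bool (s p = s q)" .
    \<comment> \<open>This makes the truncated subtraction of naturals exact when passing to
      integers.\<close>
    moreover have "2 * of_bool (s p = s q) \<le> card (cell T a b \<inter> cell T c d)"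
      using card_mono[OF _ W] finite_cell[OF sls ab(3,4)] ne[of "s p"] s_less[of p] pq by auto
    ultimately show ?thesis
      using card_cell_inter[OF U, of 2 a b c d] ab by (auto simp: of_bool_def split: if_splits)
  qed
  interpret covered_net G fst snd s "symbols T - Z" B
  proof
    show "bij_betw (\<lambda>p. (fst p, snd p)) G ({..<6} \<times> {..<6})" by (simp add: G_def bij_betw_def)
    show "finite (symbols T - Z)" using sls by (simp add: semi_latin_square_def)
    show "B z \<subseteq> G" for z by (auto simp: B_def G_def)
    show "card (B z) = 6" if "z \<in> symbols T - Z" for z
      unfolding B_def using that card_symbol_block[OF sls] by simp
  qed (fact rs cs pair_count)+
  show False by (rule inconsistent)
qed

text \<open>If neither alternative holds, the two preceding lemmas exclude row and column labels
  from both families, so the symbols form a doubled Latin square.\<close>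

lemma doubled_parallel_class:
  fixes T :: "'a square" and s :: "nat \<times> nat \<Rightarrow> nat"
  defines "G \<equiv> {..<6 :: nat} \<times> {..<6 :: nat}"
  assumes U: "uniform_sls 6 10 T"
    and s_less: "\<And>p. p \<in> G \<Longrightarrow> s p < 6"
    and lab: "\<And>i. i < 6 \<Longrightarrow> l i \<in> labels (Delta3 6 2 T)" "\<And>i. i < 6 \<Longrightarrow> l' i \<in> labels (Delta3 6 2 T)"
    and ne: "\<And>i. i < 6 \<Longrightarrow> l i \<noteq> l' i"
    and bl: "\<And>i. i < 6 \<Longrightarrow> block (Delta3 6 2 T) (l i) = {p \<in> G. s p = i}"
      "\<And>i. i < 6 \<Longrightarrow> block (Delta3 6 2 T) (l' i) = {p \<in> G. s p = i}"
  shows "(\<forall>p\<in>G. \<forall>q\<in>G. s p = s q \<longleftrightarrow> fst p = fst q) \<or> (\<forall>p\<in>G. \<forall>q\<in>G. s p = s q \<longleftrightarrow> snd p = snd q)"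
proof (rule ccontr)
  assume neg: "\<not> ?thesis"
  have sls: "semi_latin_square 6 10 T" using U by (simp add: uniform_sls_def)
  have orig: "\<exists>x\<in>symbols T. L i = Orig x"
    if i: "i < 6" and lab: "\<And>i. i < 6 \<Longrightarrow> L i \<in> labels (Delta3 6 2 T)"
      and bl: "\<And>i. i < 6 \<Longrightarrow> block (Delta3 6 2 T) (L i) = {p \<in> G. s p = i}" for L i
    using lab[OF i]
  proof (cases rule: label_cases)
    case (row a m)
    then show ?thesis
      using neg row_in_parallel_class[OF sls, of s L 2 i a m] s_less lab bl i unfolding G_def by blast
  next
    case (col a m)
    then show ?thesis
      using neg column_in_parallel_class[OF sls, of s L 2 i a m] s_less lab bl i unfolding G_def by blast
  qed auto
  obtain x where x: "\<And>i. i < 6 \<Longrightarrow> x i \<in> symbols T \<and> l i = Orig (x i)"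
    using orig[OF _ lab(1) bl(1)] by metis
  obtain y where y: "\<And>i. i < 6 \<Longrightarrow> y i \<in> symbols T \<and> l' i = Orig (y i)"
    using orig[OF _ lab(2) bl(2)] by metis
  show False
  proof (rule no_doubled_latin_square[OF U, of s x y])
    show "x i \<in> cell T a b \<longleftrightarrow> s (a, b) = i" if "i < 6" "a < 6" "b < 6" for i a b
      using bl(1)[OF that(1)] x[OF that(1)] that by (auto simp: block_Delta3_Orig G_def set_eq_iff)
    show "y i \<in> cell T a b \<longleftrightarrow> s (a, b) = i" if "i < 6" "a < 6" "b < 6" for i a b
      using bl(2)[OF that(1)] y[OF that(1)] that by (auto simp: block_Delta3_Orig G_def set_eq_iff)
    show "x i \<noteq> y i" if "i < 6" for i
      using x[OF that] y[OF that] ne[OF that] by auto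
  qed (use s_less x y in \<open>auto simp: G_def\<close>)
qed

lemma sls_isomorphic_of_design_isomorphic:
  fixes S T :: "'a square"
  assumes US: "uniform_sls 6 10 S" and UT: "uniform_sls 6 10 T"
    and iso: "design_isomorphic (Delta3 6 2 S) (Delta3 6 2 T)"
  shows "sls_isomorphic 6 S T"
proof -
  let ?G = "{..<6 :: nat} \<times> {..<6 :: nat}" and ?DS = "Delta3 6 2 S" and ?DT = "Delta3 6 2 T"
  have S: "semi_latin_square 6 10 S" and T: "semi_latin_square 6 10 T"
    using US UT by (simp_all add: uniform_sls_def)
  obtain f g where f: "bij_betw f ?G ?G" and g: "bij_betw g (labels ?DS) (labels ?DT)"
    and fg: "\<And>l. l \<in> labels ?DS \<Longrightarrow> block ?DT (g l) = f ` block ?DS l"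
    using iso by (auto simp: design_isomorphic_def treatments_Delta3)
  \<comment> \<open>The inverse map leads from cells of \<open>T\<close> to cells of
    \<open>S\<close>, so rows and columns of \<open>S\<close> pull back to fibres of its two
    components.\<close>
  define \<phi> where "\<phi> = the_inv_into ?G f"
  have \<phi>: "bij_betw \<phi> ?G ?G" unfolding \<phi>_def using f by (rule bij_betw_the_inv_into)
  have \<phi>_G: "\<phi> p \<in> ?G" and f\<phi>: "f (\<phi> p) = p" if "p \<in> ?G" for p
    using bij_betwE[OF \<phi>] f_the_inv_into_f_bij_betw[OF f] that by (auto simp: \<phi>_def)
  have blocks: "block ?DS l \<subseteq> ?G" if "l \<in> labels ?DS" for l
    using that by (cases rule: label_cases) (auto simp: block_Delta3)
  have fblock: "block ?DT (g l) = {p \<in> ?G. \<phi> p \<in> block ?DS l}" if "l \<in> labels ?DS" for l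
  proof -
    have "f ` block ?DS l = {p \<in> ?G. \<phi> p \<in> block ?DS l}"
    proof (intro equalityI subsetI)
      fix p assume "p \<in> f ` block ?DS l"
      then obtain q where q: "q \<in> block ?DS l" "p = f q" by blast
      then have "q \<in> ?G" using blocks[OF that] by blast
      moreover have "\<phi> p = q"
        using q \<open>q \<in> ?G\<close> the_inv_into_f_f[OF bij_betw_imp_inj_on[OF f]] by (simp add: \<phi>_def)
      moreover have "p \<in> ?G" using q \<open>q \<in> ?G\<close> bij_betwE[OF f] by blast
      ultimately show "p \<in> {p \<in> ?G. \<phi> p \<in> block ?DS l}" using q by simp
    next
      fix p assume "p \<in> {p \<in> ?G. \<phi> p \<in> block ?DS l}"
      then show "p \<in> f ` block ?DS l" using f\<phi>[of p] by force
    qed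
    then show ?thesis using fg[OF that] by simp
  qed
  have row_lab: "Row i m \<in> labels ?DS" and col_lab: "Col i m \<in> labels ?DS" if "i < 6" "m < 2" for i m
    using that by (auto simp: labels_Delta3)
  have g_lab: "g l \<in> labels ?DT" if "l \<in> labels ?DS" for l
    using bij_betwE[OF g] that by blast
  have g_inj: "g l = g l' \<longleftrightarrow> l = l'" if "l \<in> labels ?DS" "l' \<in> labels ?DS" for l l'
    using bij_betw_imp_inj_on[OF g] that by (auto dest: inj_onD)
  \<comment> \<open>\<open>Row i 0\<close> and \<open>Row i 1\<close> are distinct labels with equal
    blocks, so their images under \<open>g\<close> form a doubled parallel class of
    \<open>T\<close>.\<close>
  have fst_class: "(\<forall>p\<in>?G. \<forall>q\<in>?G. fst (\<phi> p) = fst (\<phi> q) \<longleftrightarrow> fst p = fst q) \<or>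
      (\<forall>p\<in>?G. \<forall>q\<in>?G. fst (\<phi> p) = fst (\<phi> q) \<longleftrightarrow> snd p = snd q)"
  proof (rule doubled_parallel_class[OF UT, of "\<lambda>p. fst (\<phi> p)" "\<lambda>i. g (Row i 0)" "\<lambda>i. g (Row i 1)"])
    show "block ?DT (g (Row i 0)) = {p \<in> ?G. fst (\<phi> p) = i}"
      "block ?DT (g (Row i 1)) = {p \<in> ?G. fst (\<phi> p) = i}" if "i < 6" for i
      using that fblock[OF row_lab] \<phi>_G by (auto simp: block_Delta3 mem_Times_iff)
  qed (use \<phi>_G g_lab row_lab g_inj in \<open>auto simp: mem_Times_iff\<close>)
  have snd_class: "(\<forall>p\<in>?G. \<forall>q\<in>?G. snd (\<phi> p) = snd (\<phi> q) \<longleftrightarrow> fst p = fst q) \<or>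
      (\<forall>p\<in>?G. \<forall>q\<in>?G. snd (\<phi> p) = snd (\<phi> q) \<longleftrightarrow> snd p = snd q)"
  proof (rule doubled_parallel_class[OF UT, of "\<lambda>p. snd (\<phi> p)" "\<lambda>i. g (Col i 0)" "\<lambda>i. g (Col i 1)"])
    show "block ?DT (g (Col i 0)) = {p \<in> ?G. snd (\<phi> p) = i}"
      "block ?DT (g (Col i 1)) = {p \<in> ?G. snd (\<phi> p) = i}" if "i < 6" for i
      using that fblock[OF col_lab] \<phi>_G by (auto simp: block_Delta3 mem_Times_iff)
  qed (use \<phi>_G g_lab col_lab g_inj in \<open>auto simp: mem_Times_iff\<close>)
  have \<phi>_inj: "p = q" if "p \<in> ?G" "q \<in> ?G" "fst (\<phi> p) = fst (\<phi> q)" "snd (\<phi> p) = snd (\<phi> q)" for p q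
    using bij_betw_imp_inj_on[OF \<phi>] that by (auto dest: inj_onD intro: prod_eqI)
  have inc: "(i, j) \<in> block ?DT (g (Orig x)) \<longleftrightarrow> x \<in> cell S (fst (\<phi> (i, j))) (snd (\<phi> (i, j)))"
    if "x \<in> symbols S" "i < 6" "j < 6" for x i j
    using fblock[of "Orig x"] \<phi>_G[of "(i, j)"] that
    by (auto simp: labels_Delta3 block_Delta3_Orig mem_Times_iff split: prod.splits)
  have inj_O: "inj_on (g \<circ> Orig) (symbols S)"
    using g_inj by (auto simp: inj_on_def labels_Delta3)
  have O_lab: "g (Orig x) \<in> labels ?DT" if "x \<in> symbols S" for x
    using that g_lab by (auto simp: labels_Delta3)
  have perm: "\<exists>\<pi>. \<pi> permutes {..<6} \<and> (\<forall>i<6. \<pi> i = h i)"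
    if "\<And>i. i < 6 \<Longrightarrow> h i < 6" "\<And>i j. \<lbrakk>i < 6; j < 6; h i = h j\<rbrakk> \<Longrightarrow> i = j" for h :: "nat \<Rightarrow> nat"
  proof -
    \<comment> \<open>\<open>permutes\<close> demands the identity outside the index range.\<close>
    let ?\<pi> = "\<lambda>i. if i < 6 then h i else i"
    have "inj_on ?\<pi> {..<6}" using that by (auto simp: inj_on_def)
    then have "?\<pi> permutes {..<6}"
      using that(1) by (intro bij_imp_permutes bij_betw_imageI endo_inj_surj) auto
    then show ?thesis by (intro exI[of _ ?\<pi>]) simp
  qed
  \<comment> \<open>Were both components constant on the same kind of line, two distinct cells of
    such a line would have equal images under \<open>\<phi>\<close>.\<close>
  consider (direct) "\<forall>p\<in>?G. \<forall>q\<in>?G. fst (\<phi> p) = fst (\<phi> q) \<longleftrightarrow> fst p = fst q"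
      "\<forall>p\<in>?G. \<forall>q\<in>?G. snd (\<phi> p) = snd (\<phi> q) \<longleftrightarrow> snd p = snd q"
    | (swapped) "\<forall>p\<in>?G. \<forall>q\<in>?G. fst (\<phi> p) = fst (\<phi> q) \<longleftrightarrow> snd p = snd q"
      "\<forall>p\<in>?G. \<forall>q\<in>?G. snd (\<phi> p) = snd (\<phi> q) \<longleftrightarrow> fst p = fst q"
  proof -
    have "\<not> ((\<forall>p\<in>?G. \<forall>q\<in>?G. fst (\<phi> p) = fst (\<phi> q) \<longleftrightarrow> fst p = fst q) \<and>
      (\<forall>p\<in>?G. \<forall>q\<in>?G. snd (\<phi> p) = snd (\<phi> q) \<longleftrightarrow> fst p = fst q))"
      using \<phi>_inj[of "(0, 0)" "(0, 1)"] by force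
    moreover have "\<not> ((\<forall>p\<in>?G. \<forall>q\<in>?G. fst (\<phi> p) = fst (\<phi> q) \<longleftrightarrow> snd p = snd q) \<and>
      (\<forall>p\<in>?G. \<forall>q\<in>?G. snd (\<phi> p) = snd (\<phi> q) \<longleftrightarrow> snd p = snd q))"
      using \<phi>_inj[of "(0, 0)" "(1, 0)"] by force
    ultimately show ?thesis using fst_class snd_class that by argo
  qed
  then show ?thesis
  proof cases
    case direct
    have "\<exists>\<rho>. \<rho> permutes {..<6} \<and> (\<forall>i<6. \<rho> i = fst (\<phi> (i, 0)))"
      using direct(1) \<phi>_G by (intro perm) (auto simp: mem_Times_iff)
    then obtain \<rho> where \<rho>: "\<rho> permutes {..<6}" "\<And>i. i < 6 \<Longrightarrow> \<rho> i = fst (\<phi> (i, 0))" by blast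
    have "\<exists>\<kappa>. \<kappa> permutes {..<6} \<and> (\<forall>j<6. \<kappa> j = snd (\<phi> (0, j)))"
      using direct(2) \<phi>_G by (intro perm) (auto simp: mem_Times_iff)
    then obtain \<kappa> where \<kappa>: "\<kappa> permutes {..<6}" "\<And>j. j < 6 \<Longrightarrow> \<kappa> j = snd (\<phi> (0, j))" by blast
    have "fst (\<phi> (i, j)) = \<rho> i" "snd (\<phi> (i, j)) = \<kappa> j" if "i < 6" "j < 6" for i j
      using direct that by (auto simp: \<rho> \<kappa>)
    then show ?thesis
      using inc by (intro sls_isomorphic_of_label_map[OF S T \<rho>(1) \<kappa>(1) inj_O O_lab]) auto
  next
    case swapped
    \<comment> \<open>Transposing first reduces this case to a direct one.\<close>
    define S' where "S' = \<lparr>symbols = symbols S, cell = (\<lambda>i j. cell S j i)\<rparr>"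
    have step: "sls_step 6 S S'" by (rule sls_step.transpose) (simp_all add: S'_def)
    have S': "semi_latin_square 6 10 S'"
      using S by (simp add: S'_def semi_latin_square_def)
    have "\<exists>\<rho>. \<rho> permutes {..<6} \<and> (\<forall>i<6. \<rho> i = snd (\<phi> (i, 0)))"
      using swapped(2) \<phi>_G by (intro perm) (auto simp: mem_Times_iff)
    then obtain \<rho> where \<rho>: "\<rho> permutes {..<6}" "\<And>i. i < 6 \<Longrightarrow> \<rho> i = snd (\<phi> (i, 0))" by blast
    have "\<exists>\<kappa>. \<kappa> permutes {..<6} \<and> (\<forall>j<6. \<kappa> j = fst (\<phi> (0, j)))"
      using swapped(1) \<phi>_G by (intro perm) (auto simp: mem_Times_iff)
    then obtain \<kappa> where \<kappa>: "\<kappa> permutes {..<6}" "\<And>j. j < 6 \<Longrightarrow> \<kappa> j = fst (\<phi> (0, j))" by blast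
    have "snd (\<phi> (i, j)) = \<rho> i" "fst (\<phi> (i, j)) = \<kappa> j" if "i < 6" "j < 6" for i j
      using swapped that by (auto simp: \<rho> \<kappa>)
    then have "sls_isomorphic 6 S' T"
      using inc inj_O O_lab
      by (intro sls_isomorphic_of_label_map[OF S' T \<rho>(1) \<kappa>(1), of g 2]) (auto simp: S'_def)
    then show ?thesis
      using step unfolding sls_isomorphic_def by (rule converse_rtranclp_into_rtranclp[rotated])
  qed
qed

section \<open>Isomorphism classes and their representatives\<close>

text \<open>Undoing a renaming uses that cells lie in the symbol set, as the bijection is only
  controlled there. The inclusion is carried into the conclusion so that it persists along chains of
  steps.\<close>

lemma sls_step_sym:
  assumes "sls_step n S T" and sub: "\<And>i j. i < n \<Longrightarrow> j < n \<Longrightarrow> cell S i j \<subseteq> symbols S"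
  shows "sls_step n T S \<and> (\<forall>i<n. \<forall>j<n. cell T i j \<subseteq> symbols T)"
  using assms(1)
proof cases
  case (permute_rows p)
  have less: "p i < n \<longleftrightarrow> i < n" "inv p i < n \<longleftrightarrow> i < n" for i
    using permutes_in_image[OF permute_rows(1)] permutes_in_image[OF permutes_inv[OF permute_rows(1)]] by auto
  have "sls_step n T S"
    using permute_rows less
    by (intro sls_step.permute_rows[OF permutes_inv[OF permute_rows(1)]]) (auto simp: permutes_inverses)
  then show ?thesis using permute_rows less sub by auto
next
  case (permute_columns p)
  have less: "p i < n \<longleftrightarrow> i < n" "inv p i < n \<longleftrightarrow> i < n" for i
    using permutes_in_image[OF permute_columns(1)] permutes_in_image[OF permutes_inv[OF permute_columns(1)]] by auto
  have "sls_step n T S"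
    using permute_columns less
    by (intro sls_step.permute_columns[OF permutes_inv[OF permute_columns(1)]]) (auto simp: permutes_inverses)
  then show ?thesis using permute_columns less sub by auto
next
  case transpose
  then have "sls_step n T S" by (intro sls_step.transpose) auto
  then show ?thesis using transpose sub by auto
next
  case (rename f)
  have "cell S i j = the_inv_into (symbols S) f ` cell T i j" if "i < n" "j < n" for i j
  proof -
    have "the_inv_into (symbols S) f ` f ` cell S i j = (\<lambda>x. x) ` cell S i j"
      unfolding image_image
      using sub[OF that] bij_betw_imp_inj_on[OF rename(1)]
      by (intro image_cong refl the_inv_into_f_f) auto
    then show ?thesis using rename(2)[OF that] by simp
  qed
  then have "sls_step n T S"
    by (rule sls_step.rename[OF bij_betw_the_inv_into[OF rename(1)]])
  moreover have "cell T i j \<subseteq> symbols T" if "i < n" "j < n" for i j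
    using image_mono[OF sub[OF that], of f] rename(2)[OF that] bij_betw_imp_surj_on[OF rename(1)] by simp
  ultimately show ?thesis by blast
qed

lemma sls_isomorphic_sym:
  assumes "sls_isomorphic n S T" and "\<And>i j. i < n \<Longrightarrow> j < n \<Longrightarrow> cell S i j \<subseteq> symbols S"
  shows "sls_isomorphic n T S"
proof -
  have "(sls_step n)\<^sup>*\<^sup>* T S \<and> (\<forall>i<n. \<forall>j<n. cell T i j \<subseteq> symbols T)"
    using assms(1) unfolding sls_isomorphic_def
  proof (induction rule: rtranclp_induct)
    case base
    then show ?case using assms(2) by auto
  next
    case (step T U)
    then show ?case
      using sls_step_sym[of n T U] by (meson converse_rtranclp_into_rtranclp)
  qed
  then show ?thesis by (simp add: sls_isomorphic_def)
qed

lemma equiv_sls_isomorphic: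
  "equiv {S. uniform_sls n k S} {(S, T). uniform_sls n k S \<and> uniform_sls n k T \<and> sls_isomorphic n S T}"
proof (intro equivI)
  show "refl_on {S. uniform_sls n k S} {(S, T). uniform_sls n k S \<and> uniform_sls n k T \<and> sls_isomorphic n S T}"
    by (auto simp: refl_on_def sls_isomorphic_def)
  show "sym {(S, T). uniform_sls n k S \<and> uniform_sls n k T \<and> sls_isomorphic n S T}"
    by (auto simp: sym_def uniform_sls_def intro: sls_isomorphic_sym dest: cell_subset)
  show "trans {(S, T). uniform_sls n k S \<and> uniform_sls n k T \<and> sls_isomorphic n S T}"
    by (auto simp: trans_def sls_isomorphic_def)
qed auto

text \<open>Mapping a representative to its class is injective by the uniqueness and surjective by
  the existence of representatives.\<close>

lemma card_representatives:
  fixes R :: "'a square set"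
  assumes R: "uniform_sls_representatives n k R"
  shows "card R = card (uniform_sls_classes n k :: 'a square set set)"
proof -
  let ?r = "{(S, T). uniform_sls n k S \<and> uniform_sls n k T \<and> sls_isomorphic n (S :: 'a square) T}"
  have uni: "uniform_sls n k S" if "S \<in> R" for S
    using R that by (simp add: uniform_sls_representatives_def)
  have rep: "\<exists>!T. T \<in> R \<and> sls_isomorphic n S T" if "uniform_sls n k S" for S
    using R that by (simp add: uniform_sls_representatives_def)
  have class_eq: "?r `` {S} = ?r `` {T} \<longleftrightarrow> sls_isomorphic n S T"
    if "uniform_sls n k S" "uniform_sls n k T" for S T
    using eq_equiv_class_iff[OF equiv_sls_isomorphic, of S n k T] that by simp
  have "bij_betw (\<lambda>S. ?r `` {S}) R (uniform_sls_classes n k)"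
  proof (rule bij_betw_imageI)
    show "inj_on (\<lambda>S. ?r `` {S}) R"
    proof (rule inj_onI)
      fix S T assume "S \<in> R" "T \<in> R" "?r `` {S} = ?r `` {T}"
      then have "sls_isomorphic n S T" using class_eq uni by blast
      moreover have "sls_isomorphic n S S" by (simp add: sls_isomorphic_def)
      ultimately show "S = T" using rep[OF uni[OF \<open>S \<in> R\<close>]] \<open>S \<in> R\<close> \<open>T \<in> R\<close> by blast
    qed
    show "(\<lambda>S. ?r `` {S}) ` R = uniform_sls_classes n k"
      unfolding uniform_sls_classes_def
    proof (intro equalityI subsetI)
      fix C assume "C \<in> (\<lambda>S. ?r `` {S}) ` R"
      then obtain S where S: "S \<in> R" "C = ?r `` {S}" by blast
      show "C \<in> {S. uniform_sls n k S} // ?r"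
        unfolding S(2) by (rule quotientI) (simp add: uni S(1))
    next
      fix C assume "C \<in> {S. uniform_sls n k S} // ?r"
      then obtain S where S: "uniform_sls n k S" "C = ?r `` {S}" by (auto elim: quotientE)
      then obtain T where "T \<in> R" "sls_isomorphic n S T" using rep by blast
      then have "C = ?r `` {T}" using S class_eq uni by blast
      then show "C \<in> (\<lambda>S. ?r `` {S}) ` R" using \<open>T \<in> R\<close> by blast
    qed
  qed
  then show ?thesis by (rule bij_betw_same_card)
qed

theorem mainTheorem10:
  fixes R :: "'a square set"
  assumes "uniform_sls_representatives 6 10 R"
  shows "(\<forall>S\<in>R. is_bibd 36 84 14 6 2 (Delta3 6 2 S)) \<and>
         (\<forall>S\<in>R. \<forall>T\<in>R. S \<noteq> T \<longrightarrow> \<not> design_isomorphic (Delta3 6 2 S) (Delta3 6 2 T)) \<and>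
         (card (uniform_sls_classes 6 10 :: 'a square set set) = 8615 \<longrightarrow>
            card (Delta3 6 2 ` R) = 8615)"
proof (intro conjI ballI impI notI)
  have uni: "uniform_sls 6 10 S" if "S \<in> R" for S
    using assms that by (simp add: uniform_sls_representatives_def)
  have eq: "S = T" if "S \<in> R" "T \<in> R" "design_isomorphic (Delta3 6 2 S) (Delta3 6 2 T)" for S T
  proof -
    have "sls_isomorphic 6 S T" "sls_isomorphic 6 S S"
      using that uni sls_isomorphic_of_design_isomorphic by (auto simp: sls_isomorphic_def)
    moreover have "\<exists>!U. U \<in> R \<and> sls_isomorphic 6 S U"
      using assms uni[OF \<open>S \<in> R\<close>] by (simp add: uniform_sls_representatives_def)
    ultimately show ?thesis using that by blast
  qed
  show "is_bibd 36 84 14 6 2 (Delta3 6 2 S)" if "S \<in> R" for S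
    using Delta3_is_bibd[OF uni[OF that], of 2] by simp
  show False if "S \<in> R" "T \<in> R" "S \<noteq> T" "design_isomorphic (Delta3 6 2 S) (Delta3 6 2 T)" for S T
    using eq that by blast
  have refl: "design_isomorphic D D" for D :: "(nat \<times> nat, 'a ext_treatment) block_design"
    unfolding design_isomorphic_def by (intro exI[of _ id]) simp
  \<comment> \<open>Equal designs are isomorphic, so distinct representatives have distinct
    designs.\<close>
  have "inj_on (Delta3 6 2) R"
    using eq refl by (metis inj_onI)
  then show "card (Delta3 6 2 ` R) = 8615"
    if "card (uniform_sls_classes 6 10 :: 'a square set set) = 8615"
    using that card_representatives[OF assms] by (simp add: card_image)
qed

end
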